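(* Let $(M,g_0)$ be a totally geodesic lightlike hypersurface of an $(n+2)$-dimensional Lorentzian manifold, with conformal structure $c=[g_0]_0$ and integrable screen distribution $S(TM)$, and let $D$ be a Weyl screen structure on $(M,c,S(TM))$. Suppose $D=D^g+\tilde\theta$, where $g\in c$ and $\theta_g$ is the 1-form associated to the pair $\{D,g\}$. Then $$\begin{aligned}R^D(X,Y)={}&R^g(X,Y)-2d\theta_g(X,Y)\,\mathrm{id}\\&+\left(D^g_Y\theta_g^{\sharp_g}-\theta_g(Y)\theta_g^{\sharp_g}+\tfrac12|\theta_g^{\sharp_g}|_g^2\,Y\right)\wedge X\\&-\left(D^g_X\theta_g^{\sharp_g}-\theta_g(X)\theta_g^{\sharp_g}+\tfrac12|\theta_g^{\sharp_g}|_g^2\,X\right)\wedge Y\\&+\left(\mathcal K^g(X,Y)-\mathcal K^g(Y,X)\right)\xi,\end{aligned}$$ with $$\mathcal K^g(X,Y)=i_Y(D^g_XS)+S(Y,\theta_g^{\sharp_g})\,i_Xg+S(Y,\xi)\,i_XS+\varphi_g(X)\,i_YS,$$ where the 1-form $\varphi_g$ is defined by $D^g_X\xi=\varphi_g(X)\xi$ and $X\wedge Y=g(X,\cdot)Y-g(Y,\cdot)X$.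
   Context: $M$ is a hypersurface of $(\bar M,\bar g)$ whose induced metric $g_0$ has constant rank $n$; $TM^\perp=\mathrm{Rad}\,TM=\ker g_0$ has nowhere vanishing (local) section $\xi$. A screen distribution $S(TM)$ is a complement of $TM^\perp$ in $TM$; $P:TM\to S(TM)$ is the projection along $TM^\perp$. $\eta$ is the 1-form with $\eta(\xi)=1$, $\ker\eta=S(TM)$. Totally geodesic: $\bar g(\bar\nabla_XY,\xi)=0$ for all $X,Y$ tangent to $M$. $c=[g_0]_0$ is the set of metrics $g=e^{-2f}g_0$ with $X(f)=0$ for $X\in TM^\perp$. A Weyl structure on $(M,c)$ is a torsion-free connection $D$ such that for each $g\in c$ there is a unique 1-form $\theta_g$ with $Dg=-2\theta_g\otimes g$; it is a Weyl screen structure relative to $(M,c,S(TM))$ if $D_XPY\in\Gamma(S(TM))$ for all $X,Y\in\Gamma(TM)$; then $\theta_g(\xi)=0$. The section $\xi$ is normalised so that $D_\xi\xi=0$, and for $g\in c$, $D^g$ is the torsion-free connection with $D^gg=0$, $D^g_\xi\xi=0$ and $D_XY=D^g_XY+\tilde\theta_XY$, $$\tilde\theta_XY=\theta_g(X)Y+\theta_g(Y)X-g(X,Y)\theta_g^{\sharp_g}-S(X,Y)\xi,$$ where $S$ is the symmetric $(0,2)$-tensor with $S(\xi,\xi)=0$ and $S(X,Y)=C(X,Y)+\eta(X)\theta_g(Y)$ for $X\in\Gamma(TM)$, $Y\in\Gamma(S(TM))$; $C$ is defined by $D^g_XPY=\overset{\star}{\nabla}_XPY+C(X,PY)\xi$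 with $\overset{\star}{\nabla}_XPY\in\Gamma(S(TM))$. $\omega^{\sharp_g}$ is the vector field with $\omega=g(\omega^{\sharp_g},\cdot)+\eta(\omega^{\sharp_g})\eta$; $|X|_g^2=g(X,X)$; $i_X$ is insertion of $X$ in one slot of a symmetric tensor, so $\mathcal K^g(X,Y)$ is a 1-form and $\mathcal K^g(X,Y)\xi$ is the endomorphism $Z\mapsto\mathcal K^g(X,Y)(Z)\,\xi$. Curvature of a connection $\nabla$: $R^\nabla(X,Y)=\nabla_{[X,Y]}-[\nabla_X,\nabla_Y]$; $R^g$ is the curvature of $D^g$. Convention: $d\omega(X,Y)=\frac12[X\omega(Y)-Y\omega(X)-\omega([X,Y])]$. *)

theory Defs
  imports "HOL-Analysis.Analysis" "HOL-Library.Function_Algebras"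
begin

section \<open>Smooth manifolds\<close>

text \<open>Meant for open \<open>W\<close> only.\<close>

fun Ck_on :: "nat \<Rightarrow> 'e::euclidean_space set \<Rightarrow> ('e \<Rightarrow> 'f::euclidean_space) \<Rightarrow> bool" where
  "Ck_on 0 W h \<longleftrightarrow> continuous_on W h"
| "Ck_on (Suc k) W h \<longleftrightarrow>
     (\<forall>x\<in>W. h differentiable (at x)) \<and> (\<forall>v. Ck_on k W (\<lambda>x. frechet_derivative h (at x) v))"

definition Cinf_on :: "'e::euclidean_space set \<Rightarrow> ('e \<Rightarrow> 'f::euclidean_space) \<Rightarrow> bool" where
  "Cinf_on W h \<longleftrightarrow> (\<forall>k. Ck_on k W h)"

text \<open>
  The points of a manifold form a whole type, and the manifold is given by an atlas \<open>A\<close> of charts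
  \<open>(U, \<phi>)\<close>. The values of \<open>\<phi>\<close> outside \<open>U\<close> are irrelevant.
\<close>

type_synonym ('m, 'e) atlas = "('m set \<times> ('m \<Rightarrow> 'e)) set"

definition smooth_atlas ::
  "('m::{t2_space,second_countable_topology}, 'e::euclidean_space) atlas \<Rightarrow> bool" where
  "smooth_atlas A \<longleftrightarrow>
     (\<forall>(U, \<phi>)\<in>A. open U \<and> open (\<phi> ` U) \<and> homeomorphism U (\<phi> ` U) \<phi> (inv_into U \<phi>)) \<and>
     (\<Union>(U, \<phi>)\<in>A. U) = UNIV \<and>
     (\<forall>(U, \<phi>)\<in>A. \<forall>(V, \<psi>)\<in>A. Cinf_on (\<phi> ` (U \<inter> V)) (\<psi> \<circ> inv_into U \<phi>))"

definition smooth_fun ::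
  "('m::{t2_space,second_countable_topology}, 'e::euclidean_space) atlas
     \<Rightarrow> 'm set \<Rightarrow> ('m \<Rightarrow> real) \<Rightarrow> bool" where
  "smooth_fun A W f \<longleftrightarrow> (\<forall>(U, \<phi>)\<in>A. Cinf_on (\<phi> ` (U \<inter> W)) (f \<circ> inv_into U \<phi>))"

definition smooth_near ::
  "('m::{t2_space,second_countable_topology}, 'e::euclidean_space) atlas
     \<Rightarrow> 'm \<Rightarrow> ('m \<Rightarrow> real) \<Rightarrow> bool" where
  "smooth_near A p f \<longleftrightarrow> (\<exists>W. open W \<and> p \<in> W \<and> smooth_fun A W f)"

definition smooth_map ::
  "('m::{t2_space,second_countable_topology}, 'e::euclidean_space) atlas \<Rightarrow>
   ('k::{t2_space,second_countable_topology}, 'f::euclidean_space) atlas \<Rightarrow> ('m \<Rightarrow> 'k) \<Rightarrow> bool" where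
  "smooth_map A B F \<longleftrightarrow> continuous_on UNIV F \<and>
     (\<forall>(U, \<phi>)\<in>A. \<forall>(V, \<psi>)\<in>B. Cinf_on (\<phi> ` (U \<inter> F -` V)) (\<psi> \<circ> F \<circ> inv_into U \<phi>))"

section \<open>Tangent vectors, vector fields and tensors\<close>

text \<open>
  A tangent vector at \<open>p\<close> is a derivation at \<open>p\<close> of the germs of smooth functions, represented on all
  functions and required to vanish on functions that are not smooth near \<open>p\<close>, so that equality of
  tangent vectors is equality of HOL functions. Sums are the pointwise ones of
  \<open>Function_Algebras\<close>; scalar multiples are the following.
\<close>

definition fscale :: "real \<Rightarrow> ('x \<Rightarrow> real) \<Rightarrow> ('x \<Rightarrow> real)" (infixr "*\<^sub>t" 75) where
  "c *\<^sub>t v = (\<lambda>x. c * v x)"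

global_interpretation fun_vs: vector_space fscale
  by unfold_locales (auto simp: fscale_def fun_eq_iff algebra_simps)

type_synonym 'm tangent = "('m \<Rightarrow> real) \<Rightarrow> real"
type_synonym 'm vfield = "'m \<Rightarrow> 'm tangent"
type_synonym 'm form = "'m \<Rightarrow> 'm tangent \<Rightarrow> real"
type_synonym 'm tensor2 = "'m \<Rightarrow> 'm tangent \<Rightarrow> 'm tangent \<Rightarrow> real"
type_synonym 'm connection = "'m \<Rightarrow> 'm tangent \<Rightarrow> 'm vfield \<Rightarrow> 'm tangent"

definition tangent_space ::
  "('m::{t2_space,second_countable_topology}, 'e::euclidean_space) atlas \<Rightarrow> 'm \<Rightarrow> 'm tangent set" where
  "tangent_space A p = {v.
     (\<forall>f. \<not> smooth_near A p f \<longrightarrow> v f = 0) \<and>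
     (\<forall>f h. smooth_near A p f \<and> smooth_near A p h \<longrightarrow>
        v (\<lambda>x. f x + h x) = v f + v h \<and> v (\<lambda>x. f x * h x) = f p * v h + h p * v f) \<and>
     (\<forall>c f. smooth_near A p f \<longrightarrow> v (\<lambda>x. c * f x) = c * v f) \<and>
     (\<forall>f h W. smooth_near A p f \<and> open W \<and> p \<in> W \<and> (\<forall>x\<in>W. f x = h x) \<longrightarrow> v f = v h)}"

text \<open>Smooth vector fields on the open set \<open>U\<close>; values outside \<open>U\<close> are irrelevant, and similarly for
  the other fields below.\<close>

definition vector_field ::
  "('m::{t2_space,second_countable_topology}, 'e::euclidean_space) atlas
     \<Rightarrow> 'm set \<Rightarrow> 'm vfield \<Rightarrow> bool" where
  "vector_field A U X \<longleftrightarrow> (\<forall>p\<in>U. X p \<in> tangent_space A p) \<and>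
     (\<forall>W f. open W \<and> W \<subseteq> U \<and> smooth_fun A W f \<longrightarrow> smooth_fun A W (\<lambda>p. X p f))"

definition lie_bracket ::
  "('m::{t2_space,second_countable_topology}, 'e::euclidean_space) atlas
     \<Rightarrow> 'm vfield \<Rightarrow> 'm vfield \<Rightarrow> 'm vfield" where
  "lie_bracket A X Y p =
     (\<lambda>f. if smooth_near A p f then X p (\<lambda>q. Y q f) - Y p (\<lambda>q. X q f) else 0)"

definition one_form ::
  "('m::{t2_space,second_countable_topology}, 'e::euclidean_space) atlas
     \<Rightarrow> 'm set \<Rightarrow> 'm form \<Rightarrow> bool" where
  "one_form A U \<omega> \<longleftrightarrow>
     (\<forall>p\<in>U. \<forall>u\<in>tangent_space A p. \<forall>v\<in>tangent_space A p. \<forall>c.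
        \<omega> p (u + v) = \<omega> p u + \<omega> p v \<and> \<omega> p (c *\<^sub>t u) = c * \<omega> p u) \<and>
     (\<forall>W X. open W \<and> W \<subseteq> U \<and> vector_field A W X \<longrightarrow> smooth_fun A W (\<lambda>p. \<omega> p (X p)))"

definition sym_tensor2 ::
  "('m::{t2_space,second_countable_topology}, 'e::euclidean_space) atlas
     \<Rightarrow> 'm set \<Rightarrow> 'm tensor2 \<Rightarrow> bool" where
  "sym_tensor2 A U h \<longleftrightarrow>
     (\<forall>p\<in>U. \<forall>u\<in>tangent_space A p. \<forall>v\<in>tangent_space A p. \<forall>w\<in>tangent_space A p. \<forall>c.
        h p u v = h p v u \<and> h p (u + v) w = h p u w + h p v w \<and> h p (c *\<^sub>t u) w = c * h p u w) \<and>
     (\<forall>W X Y. open W \<and> W \<subseteq> U \<and> vector_field A W X \<and> vector_field A W Y \<longrightarrow>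
        smooth_fun A W (\<lambda>p. h p (X p) (Y p)))"

text \<open>The convention with the factor 1/2.\<close>

definition ext_deriv ::
  "('m::{t2_space,second_countable_topology}, 'e::euclidean_space) atlas
     \<Rightarrow> 'm form \<Rightarrow> 'm vfield \<Rightarrow> 'm vfield \<Rightarrow> 'm \<Rightarrow> real" where
  "ext_deriv A \<omega> X Y p =
     1/2 * (X p (\<lambda>q. \<omega> q (Y q)) - Y p (\<lambda>q. \<omega> q (X q)) - \<omega> p (lie_bracket A X Y p))"

section \<open>Linear connections\<close>

text \<open>
  \<open>D p v Y\<close> is the derivative at \<open>p\<close> in direction \<open>v\<close> of a vector field \<open>Y\<close> defined near \<open>p\<close>; thus
  \<open>D\<^sub>XY\<close> at \<open>p\<close> is \<open>D p (X p) Y\<close>. Since connections are applied to local sections, locality in \<open>Y\<close>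
  is part of the definition.
\<close>

definition linear_connection ::
  "('m::{t2_space,second_countable_topology}, 'e::euclidean_space) atlas
     \<Rightarrow> 'm set \<Rightarrow> 'm connection \<Rightarrow> bool" where
  "linear_connection A U D \<longleftrightarrow>
     (\<forall>W Y. open W \<and> W \<subseteq> U \<and> vector_field A W Y \<longrightarrow>
        (\<forall>X. vector_field A W X \<longrightarrow> vector_field A W (\<lambda>p. D p (X p) Y)) \<and>
        (\<forall>p\<in>W. \<forall>v\<in>tangent_space A p.
           D p v Y \<in> tangent_space A p \<and>
           (\<forall>u\<in>tangent_space A p. D p (u + v) Y = D p u Y + D p v Y) \<and>
           (\<forall>c. D p (c *\<^sub>t v) Y = c *\<^sub>t D p v Y) \<and>
           (\<forall>Y'. vector_field A W Y' \<longrightarrow> D p v (\<lambda>q. Y q + Y' q) = D p v Y + D p v Y') \<and>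
           (\<forall>f. smooth_fun A W f \<longrightarrow>
              D p v (\<lambda>q. f q *\<^sub>t Y q) = v f *\<^sub>t Y p + f p *\<^sub>t D p v Y) \<and>
           (\<forall>Y'. (\<forall>q\<in>W. Y' q = Y q) \<longrightarrow> D p v Y' = D p v Y)))"

definition torsion_free ::
  "('m::{t2_space,second_countable_topology}, 'e::euclidean_space) atlas
     \<Rightarrow> 'm set \<Rightarrow> 'm connection \<Rightarrow> bool" where
  "torsion_free A U D \<longleftrightarrow>
     (\<forall>W X Y. open W \<and> W \<subseteq> U \<and> vector_field A W X \<and> vector_field A W Y \<longrightarrow>
        (\<forall>p\<in>W. D p (X p) Y - D p (Y p) X = lie_bracket A X Y p))"

text \<open>\<open>(D\<^sub>v h)(Y, Z)\<close> at \<open>p\<close>\<close>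

definition cov_deriv2 ::
  "'m connection \<Rightarrow> 'm tensor2 \<Rightarrow> 'm \<Rightarrow> 'm tangent \<Rightarrow> 'm vfield \<Rightarrow> 'm vfield \<Rightarrow> real" where
  "cov_deriv2 D h p v Y Z =
     v (\<lambda>q. h q (Y q) (Z q)) - h p (D p v Y) (Z p) - h p (Y p) (D p v Z)"

definition metric_connection ::
  "('m::{t2_space,second_countable_topology}, 'e::euclidean_space) atlas
     \<Rightarrow> 'm set \<Rightarrow> 'm connection \<Rightarrow> 'm tensor2 \<Rightarrow> bool" where
  "metric_connection A U D h \<longleftrightarrow>
     (\<forall>W Y Z. open W \<and> W \<subseteq> U \<and> vector_field A W Y \<and> vector_field A W Z \<longrightarrow>
        (\<forall>p\<in>W. \<forall>v\<in>tangent_space A p. cov_deriv2 D h p v Y Z = 0))"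

text \<open>Sign convention \<open>R(X,Y) = D\<^bsub>[X,Y]\<^esub> - [D\<^sub>X, D\<^sub>Y]\<close>.\<close>

definition curvature ::
  "('m::{t2_space,second_countable_topology}, 'e::euclidean_space) atlas
     \<Rightarrow> 'm connection \<Rightarrow> 'm vfield \<Rightarrow> 'm vfield \<Rightarrow> 'm vfield \<Rightarrow> 'm vfield" where
  "curvature A D X Y Z p =
     D p (lie_bracket A X Y p) Z
       - (D p (X p) (\<lambda>q. D q (Y q) Z) - D p (Y p) (\<lambda>q. D q (X q) Z))"

section \<open>Lightlike hypersurfaces of Lorentzian manifolds\<close>

definition lorentzian_metric ::
  "('m::{t2_space,second_countable_topology}, 'e::euclidean_space) atlas \<Rightarrow> 'm tensor2 \<Rightarrow> bool" where
  "lorentzian_metric A h \<longleftrightarrow> sym_tensor2 A UNIV h \<and>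
     (\<forall>p. \<exists>e :: nat \<Rightarrow> 'm tangent.
        e ` {..<DIM('e)} \<subseteq> tangent_space A p \<and>
        fun_vs.span (e ` {..<DIM('e)}) = tangent_space A p \<and>
        (\<forall>i<DIM('e). \<forall>j<DIM('e).
           h p (e i) (e j) = (if i \<noteq> j then 0 else if i = 0 then -1 else 1)))"

definition levi_civita ::
  "('m::{t2_space,second_countable_topology}, 'e::euclidean_space) atlas
     \<Rightarrow> 'm tensor2 \<Rightarrow> 'm connection \<Rightarrow> bool" where
  "levi_civita A h D \<longleftrightarrow>
     linear_connection A UNIV D \<and> torsion_free A UNIV D \<and> metric_connection A UNIV D h"

definition differential ::
  "('k::{t2_space,second_countable_topology}, 'f::euclidean_space) atlas
     \<Rightarrow> ('m \<Rightarrow> 'k) \<Rightarrow> 'm \<Rightarrow> 'm tangent \<Rightarrow> 'k tangent" where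
  "differential B F p v = (\<lambda>f. if smooth_near B (F p) f then v (f \<circ> F) else 0)"

text \<open>An (immersed) hypersurface: the manifold with atlas \<open>A\<close>, immersed by \<open>F\<close> in codimension one.\<close>

definition hypersurface ::
  "('m::{t2_space,second_countable_topology}, 'e::euclidean_space) atlas \<Rightarrow>
   ('k::{t2_space,second_countable_topology}, 'f::euclidean_space) atlas \<Rightarrow> ('m \<Rightarrow> 'k) \<Rightarrow> bool" where
  "hypersurface A B F \<longleftrightarrow>
     smooth_atlas A \<and> smooth_atlas B \<and> DIM('f) = DIM('e) + 1 \<and> smooth_map A B F \<and>
     (\<forall>p. inj_on (differential B F p) (tangent_space A p))"

definition induced_metric ::
  "('k::{t2_space,second_countable_topology}, 'f::euclidean_space) atlas
     \<Rightarrow> ('m \<Rightarrow> 'k) \<Rightarrow> 'k tensor2 \<Rightarrow> 'm tensor2" where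
  "induced_metric B F h p u v = h (F p) (differential B F p u) (differential B F p v)"

text \<open>The rank of \<open>h\<close> at \<open>p\<close>, i.e. the rank of the map \<open>u \<mapsto> h(u, \<cdot>)\<close> from the tangent space to its dual.\<close>

definition rank_at ::
  "('m::{t2_space,second_countable_topology}, 'e::euclidean_space) atlas
     \<Rightarrow> 'm tensor2 \<Rightarrow> 'm \<Rightarrow> nat" where
  "rank_at A h p =
     fun_vs.dim ((\<lambda>u v. if v \<in> tangent_space A p then h p u v else 0) ` tangent_space A p)"

definition Rad ::
  "('m::{t2_space,second_countable_topology}, 'e::euclidean_space) atlas
     \<Rightarrow> 'm tensor2 \<Rightarrow> 'm \<Rightarrow> 'm tangent set" where
  "Rad A h p = {u \<in> tangent_space A p. \<forall>v\<in>tangent_space A p. h p u v = 0}"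

text \<open>
  The ambient connection is applied to a vector field \<open>Y\<close> tangent to the hypersurface by means of a
  local extension \<open>Y'\<close>; locally on the hypersurface such an extension always exists.
\<close>

definition totally_geodesic ::
  "('m::{t2_space,second_countable_topology}, 'e::euclidean_space) atlas \<Rightarrow>
   ('k::{t2_space,second_countable_topology}, 'f::euclidean_space) atlas \<Rightarrow> ('m \<Rightarrow> 'k)
     \<Rightarrow> 'k tensor2 \<Rightarrow> 'k connection \<Rightarrow> bool" where
  "totally_geodesic A B F h D \<longleftrightarrow>
     (\<forall>U W X Y Y'. open U \<and> open W \<and> F ` U \<subseteq> W \<and> vector_field A U X \<and> vector_field A U Y \<and>
        vector_field B W Y' \<and> (\<forall>q\<in>U. Y' (F q) = differential B F q (Y q)) \<longrightarrow>
        (\<forall>p\<in>U. \<forall>\<xi>\<in>Rad A (induced_metric B F h) p.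
           h (F p) (D (F p) (differential B F p (X p)) Y') (differential B F p \<xi>) = 0))"

section \<open>Screen distributions\<close>

definition smooth_distribution ::
  "('m::{t2_space,second_countable_topology}, 'e::euclidean_space) atlas
     \<Rightarrow> nat \<Rightarrow> ('m \<Rightarrow> 'm tangent set) \<Rightarrow> bool" where
  "smooth_distribution A k S \<longleftrightarrow>
     (\<forall>p. \<exists>U E. open U \<and> p \<in> U \<and> (\<forall>i<k. vector_field A U (E i)) \<and>
        (\<forall>q\<in>U. S q = fun_vs.span ((\<lambda>i. E i q) ` {..<k}) \<and> fun_vs.dim (S q) = k))"

definition screen_distribution ::
  "('m::{t2_space,second_countable_topology}, 'e::euclidean_space) atlas
     \<Rightarrow> nat \<Rightarrow> 'm tensor2 \<Rightarrow> ('m \<Rightarrow> 'm tangent set) \<Rightarrow> bool" where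
  "screen_distribution A n g\<^sub>0 S \<longleftrightarrow> smooth_distribution A n S \<and>
     (\<forall>p. S p \<inter> Rad A g\<^sub>0 p = {0} \<and>
        {u + w |u w. u \<in> S p \<and> w \<in> Rad A g\<^sub>0 p} = tangent_space A p)"

text \<open>Integrability in terms of flat charts: in suitable coordinates \<open>S\<close> is spanned by coordinate vector
  fields, namely by those in the directions of \<open>Basis - B\<close>.\<close>

definition integrable_distribution ::
  "('m::{t2_space,second_countable_topology}, 'e::euclidean_space) atlas
     \<Rightarrow> ('m \<Rightarrow> 'm tangent set) \<Rightarrow> bool" where
  "integrable_distribution A S \<longleftrightarrow>
     (\<forall>p. \<exists>U \<phi>. \<exists>B\<subseteq>Basis. p \<in> U \<and> smooth_atlas (insert (U, \<phi>) A) \<and>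
        (\<forall>q\<in>U. S q = {v \<in> tangent_space A q. \<forall>b\<in>B. v (\<lambda>x. \<phi> x \<bullet> b) = 0}))"

definition screen_proj ::
  "('m::{t2_space,second_countable_topology}, 'e::euclidean_space) atlas
     \<Rightarrow> 'm tensor2 \<Rightarrow> ('m \<Rightarrow> 'm tangent set) \<Rightarrow> 'm \<Rightarrow> 'm tangent \<Rightarrow> 'm tangent" where
  "screen_proj A g\<^sub>0 S p v = (THE u. u \<in> S p \<and> v - u \<in> Rad A g\<^sub>0 p)"

section \<open>Weyl screen structures\<close>

definition conformal_class ::
  "('m::{t2_space,second_countable_topology}, 'e::euclidean_space) atlas
     \<Rightarrow> 'm tensor2 \<Rightarrow> 'm tensor2 set" where
  "conformal_class A g\<^sub>0 = {g. \<exists>f. smooth_fun A UNIV f \<and> (\<forall>p. \<forall>v\<in>Rad A g\<^sub>0 p. v f = 0) \<and>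
     (\<forall>p. \<forall>u\<in>tangent_space A p. \<forall>v\<in>tangent_space A p. g p u v = exp (-2 * f p) * g\<^sub>0 p u v)}"

text \<open>\<open>Dg = -2\<theta> \<otimes> g\<close>\<close>

definition weyl_form ::
  "('m::{t2_space,second_countable_topology}, 'e::euclidean_space) atlas
     \<Rightarrow> 'm connection \<Rightarrow> 'm tensor2 \<Rightarrow> 'm form \<Rightarrow> bool" where
  "weyl_form A D g \<theta> \<longleftrightarrow> one_form A UNIV \<theta> \<and>
     (\<forall>W Y Z. open W \<and> vector_field A W Y \<and> vector_field A W Z \<longrightarrow>
        (\<forall>p\<in>W. \<forall>v\<in>tangent_space A p. cov_deriv2 D g p v Y Z = -2 * \<theta> p v * g p (Y p) (Z p)))"

definition weyl_structure ::
  "('m::{t2_space,second_countable_topology}, 'e::euclidean_space) atlas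
     \<Rightarrow> 'm tensor2 set \<Rightarrow> 'm connection \<Rightarrow> bool" where
  "weyl_structure A c D \<longleftrightarrow> linear_connection A UNIV D \<and> torsion_free A UNIV D \<and>
     (\<forall>g\<in>c. \<exists>\<theta>. weyl_form A D g \<theta> \<and>
        (\<forall>\<theta>'. weyl_form A D g \<theta>' \<longrightarrow> (\<forall>p. \<forall>v\<in>tangent_space A p. \<theta>' p v = \<theta> p v)))"

definition weyl_screen_structure ::
  "('m::{t2_space,second_countable_topology}, 'e::euclidean_space) atlas
     \<Rightarrow> 'm tensor2 \<Rightarrow> ('m \<Rightarrow> 'm tangent set) \<Rightarrow> 'm connection \<Rightarrow> bool" where
  "weyl_screen_structure A g\<^sub>0 S D \<longleftrightarrow> weyl_structure A (conformal_class A g\<^sub>0) D \<and>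
     (\<forall>W X Y. open W \<and> vector_field A W X \<and> vector_field A W Y \<longrightarrow>
        (\<forall>p\<in>W. D p (X p) (\<lambda>q. screen_proj A g\<^sub>0 S q (Y q)) \<in> S p))"

text \<open>
  The following notions live on an open set \<open>U\<close> on which a section \<open>\<xi>\<close> of the radical distribution is
  given. \<open>T\<close> is the tensor field usually called \<open>S\<close>; here \<open>S\<close> is the screen distribution.
\<close>

definition is_sharp ::
  "('m::{t2_space,second_countable_topology}, 'e::euclidean_space) atlas
     \<Rightarrow> 'm set \<Rightarrow> 'm tensor2 \<Rightarrow> 'm form \<Rightarrow> 'm form \<Rightarrow> 'm vfield \<Rightarrow> bool" where
  "is_sharp A U g \<eta> \<omega> V \<longleftrightarrow> vector_field A U V \<and>
     (\<forall>p\<in>U. \<forall>w\<in>tangent_space A p. \<omega> p w = g p (V p) w + \<eta> p (V p) * \<eta> p w)"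

text \<open>\<open>D\<^sub>X PY = \<nabla>\<^sup>*\<^sub>X PY + C(X, PY) \<xi>\<close> with \<open>\<nabla>\<^sup>*\<^sub>X PY\<close> (below: \<open>w\<close>) in the screen distribution\<close>

definition screen_second_form ::
  "('m::{t2_space,second_countable_topology}, 'e::euclidean_space) atlas
     \<Rightarrow> 'm set \<Rightarrow> 'm tensor2 \<Rightarrow> ('m \<Rightarrow> 'm tangent set) \<Rightarrow> 'm vfield \<Rightarrow> 'm connection \<Rightarrow> 'm tensor2 \<Rightarrow> bool"
  where
  "screen_second_form A U g\<^sub>0 S \<xi> D C \<longleftrightarrow>
     (\<forall>W X Y. open W \<and> W \<subseteq> U \<and> vector_field A W X \<and> vector_field A W Y \<longrightarrow>
        (\<forall>p\<in>W. \<exists>w\<in>S p. D p (X p) (\<lambda>q. screen_proj A g\<^sub>0 S q (Y q)) =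
           w + C p (X p) (screen_proj A g\<^sub>0 S p (Y p)) *\<^sub>t \<xi> p))"

definition theta_tilde ::
  "'m tensor2 \<Rightarrow> 'm form \<Rightarrow> 'm vfield \<Rightarrow> 'm tensor2 \<Rightarrow> 'm vfield
     \<Rightarrow> 'm \<Rightarrow> 'm tangent \<Rightarrow> 'm tangent \<Rightarrow> 'm tangent" where
  "theta_tilde g \<theta> \<theta>s T \<xi> p x y =
     \<theta> p x *\<^sub>t y + \<theta> p y *\<^sub>t x - g p x y *\<^sub>t \<theta>s p - T p x y *\<^sub>t \<xi> p"

text \<open>The endomorphism \<open>x \<and> y = g(x, \<cdot>) y - g(y, \<cdot>) x\<close>\<close>

definition wedge_endo ::
  "'m tensor2 \<Rightarrow> 'm \<Rightarrow> 'm tangent \<Rightarrow> 'm tangent \<Rightarrow> 'm tangent \<Rightarrow> 'm tangent" where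
  "wedge_endo g p x y = (\<lambda>z. g p x z *\<^sub>t y - g p y z *\<^sub>t x)"

text \<open>The vector field \<open>D\<^sub>X\<theta>\<^sup>\<sharp> - \<theta>(X)\<theta>\<^sup>\<sharp> + 1/2 |\<theta>\<^sup>\<sharp>|\<^sup>2 X\<close>\<close>

definition wedge_term ::
  "'m tensor2 \<Rightarrow> 'm connection \<Rightarrow> 'm form \<Rightarrow> 'm vfield \<Rightarrow> 'm vfield \<Rightarrow> 'm vfield" where
  "wedge_term g Dg \<theta> \<theta>s X p =
     Dg p (X p) \<theta>s - \<theta> p (X p) *\<^sub>t \<theta>s p + (1/2 * g p (\<theta>s p) (\<theta>s p)) *\<^sub>t X p"

text \<open>The 1-form \<open>K(X, Y)\<close>, evaluated on \<open>Z\<close>\<close>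

definition K_form ::
  "'m tensor2 \<Rightarrow> 'm connection \<Rightarrow> 'm vfield \<Rightarrow> 'm tensor2 \<Rightarrow> 'm vfield \<Rightarrow> 'm form
     \<Rightarrow> 'm vfield \<Rightarrow> 'm vfield \<Rightarrow> 'm vfield \<Rightarrow> 'm \<Rightarrow> real" where
  "K_form g Dg \<theta>s T \<xi> \<phi> X Y Z p =
     cov_deriv2 Dg T p (X p) Y Z + T p (Y p) (\<theta>s p) * g p (X p) (Z p)
       + T p (Y p) (\<xi> p) * T p (X p) (Z p) + \<phi> p (X p) * T p (Y p) (Z p)"

end

theory Submission
  imports Defs
begin

text \<open>
  With \<open>D = D\<^sup>g + H\<close>, \<open>H = theta_tilde\<close>, the difference \<open>R\<^sup>D - R\<^sup>g\<close> is \<open>-(D\<^sup>g\<^sub>X H)(Y, Z) - H(X, H(Y, Z))\<close>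
  minus the same with \<open>X\<close> and \<open>Y\<close> exchanged. From
  \<open>D\<^sub>\<xi> \<xi> = D\<^sup>g\<^sub>\<xi> \<xi> = 0\<close> one gets \<open>\<theta>(\<xi>) = 0\<close>, so that \<open>\<theta> = g(\<theta>\<^sup>\<sharp>, \<cdot>)\<close>; together with \<open>D\<^sup>gg = 0\<close> and
  \<open>D\<^sup>g\<xi> = \<phi> \<otimes> \<xi>\<close> the two terms expand to the claimed formula, the terms \<open>\<theta> \<otimes> T\<close> cancelling.
  The Leibniz rule for \<open>g(Y, Z) \<theta>\<^sup>\<sharp>\<close> requires \<open>g(Y, Z)\<close> to be smooth. This is deduced from the
  existence of the metric connection, which avoids extending fields to the ambient manifold.
\<close>

section \<open>Calculus on manifolds\<close>

lemma Ck_on_subset: "Ck_on k W h \<Longrightarrow> W' \<subseteq> W \<Longrightarrow> Ck_on k W' h"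
proof (induction k arbitrary: h)
  case 0
  then show ?case by (auto intro: continuous_on_subset)
next
  case (Suc k)
  then show ?case by (auto)
qed

text \<open>The derivative at a point depends on values nearby; openness keeps these inside
  \<open>W\<close>, where the two functions agree.\<close>

lemma Ck_on_cong_imp:
  assumes "Ck_on k W f" "open W" "\<And>x. x \<in> W \<Longrightarrow> f x = h x"
  shows "Ck_on k W h"
  using assms
proof (induction k arbitrary: f h)
  case 0
  then show ?case using continuous_on_cong[of W W f h] by simp
next
  case (Suc k)
  have der: "(h has_derivative frechet_derivative f (at x)) (at x)" if "x \<in> W" for x
  proof -
    have "(f has_derivative frechet_derivative f (at x)) (at x)"
      using Suc.prems(1) that by (simp add: frechet_derivative_works)
    then show ?thesis
      using has_derivative_transform_within_open[OF _ Suc.prems(2) that] Suc.prems(3) by blast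
  qed
  then have eq: "frechet_derivative h (at x) = frechet_derivative f (at x)" if "x \<in> W" for x
    using that frechet_derivative_at by fastforce
  show ?case
  proof (simp, intro conjI ballI allI)
    fix x assume "x \<in> W"
    then show "h differentiable at x" using der differentiable_def by blast
  next
    fix v
    show "Ck_on k W (\<lambda>x. frechet_derivative h (at x) v)"
    proof (rule Suc.IH)
      show "Ck_on k W (\<lambda>x. frechet_derivative f (at x) v)" using Suc.prems(1) by simp
    qed (simp_all add: Suc.prems(2) eq)
  qed
qed

text \<open>The recursion asks for continuity only at level 0, so the inclusion is proved by
  descending through the derivatives until differentiability yields continuity.\<close>

lemma Ck_on_SucD: "Ck_on (Suc k) W h \<Longrightarrow> Ck_on k W h"
proof (induction k arbitrary: h)
  case 0
  then show ?case
    by (auto intro!: differentiable_imp_continuous_on differentiable_at_imp_differentiable_on)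
next
  case (Suc k)
  have "\<forall>x\<in>W. h differentiable (at x)"
    and "\<forall>v. Ck_on (Suc k) W (\<lambda>x. frechet_derivative h (at x) v)"
    using Suc.prems by (auto simp del: Ck_on.simps simp: Ck_on.simps(2)[of "Suc k"])
  then show ?case using Suc.IH by simp
qed

text \<open>Lets the derivative be given by an explicit formula in place of
  \<open>frechet_derivative\<close>, so that the sum, product and chain rules fit an induction on
  \<open>k\<close>.\<close>

lemma Ck_on_SucI:
  assumes "open W" "\<And>x. x \<in> W \<Longrightarrow> (h has_derivative h' x) (at x)" "\<And>v. Ck_on k W (\<lambda>x. h' x v)"
  shows "Ck_on (Suc k) W h"
proof -
  have "frechet_derivative h (at x) = h' x" if "x \<in> W" for x
    using assms(2)[OF that] frechet_derivative_at by fastforce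
  then have "Ck_on k W (\<lambda>x. frechet_derivative h (at x) v)" for v
    by (intro Ck_on_cong_imp[OF assms(3)[of v] assms(1)]) simp
  then show ?thesis using assms(2) by (auto simp: differentiable_def)
qed

lemma Ck_on_SucE:
  assumes "Ck_on (Suc k) W h"
  obtains h' where "\<And>x. x \<in> W \<Longrightarrow> (h has_derivative h' x) (at x)" "\<And>v. Ck_on k W (\<lambda>x. h' x v)"
  using assms by (auto simp: frechet_derivative_works intro: that)

lemma Ck_on_const:
  assumes "open W"
  shows "Ck_on k W (\<lambda>_. c)"
proof (induction k arbitrary: c)
  case (Suc k)
  show ?case by (rule Ck_on_SucI[OF assms, where h' = "\<lambda>_ _. 0"]) (auto intro: Suc)
qed simp

lemma Ck_on_add:
  assumes "open W" "Ck_on k W f" "Ck_on k W h"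
  shows "Ck_on k W (\<lambda>x. f x + h x)"
  using assms(2,3)
proof (induction k arbitrary: f h)
  case 0
  then show ?case by (auto intro: continuous_on_add)
next
  case (Suc k)
  obtain f' where f': "\<And>x. x \<in> W \<Longrightarrow> (f has_derivative f' x) (at x)" "\<And>v. Ck_on k W (\<lambda>x. f' x v)"
    using Ck_on_SucE[OF Suc.prems(1)] by blast
  obtain h' where h': "\<And>x. x \<in> W \<Longrightarrow> (h has_derivative h' x) (at x)" "\<And>v. Ck_on k W (\<lambda>x. h' x v)"
    using Ck_on_SucE[OF Suc.prems(2)] by blast
  show ?case
    by (rule Ck_on_SucI[OF assms(1), where h' = "\<lambda>x v. f' x v + h' x v"])
      (use f' h' Suc.IH in \<open>auto intro: has_derivative_add\<close>)
qed

lemma Ck_on_mult: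
  fixes f h :: "'e::euclidean_space \<Rightarrow> real"
  assumes "open W" "Ck_on k W f" "Ck_on k W h"
  shows "Ck_on k W (\<lambda>x. f x * h x)"
  using assms(2,3)
proof (induction k arbitrary: f h)
  case 0
  then show ?case by (auto intro: continuous_on_mult)
next
  case (Suc k)
  obtain f' where f': "\<And>x. x \<in> W \<Longrightarrow> (f has_derivative f' x) (at x)" "\<And>v. Ck_on k W (\<lambda>x. f' x v)"
    using Ck_on_SucE[OF Suc.prems(1)] by blast
  obtain h' where h': "\<And>x. x \<in> W \<Longrightarrow> (h has_derivative h' x) (at x)" "\<And>v. Ck_on k W (\<lambda>x. h' x v)"
    using Ck_on_SucE[OF Suc.prems(2)] by blast
  show ?case
    by (rule Ck_on_SucI[OF assms(1), where h' = "\<lambda>x v. f x * h' x v + f' x v * h x"])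
      (auto intro!: has_derivative_mult f' h' Ck_on_add Suc.IH Ck_on_SucD[OF Suc.prems(1)]
        Ck_on_SucD[OF Suc.prems(2)] assms(1) simp del: Ck_on.simps)
qed

lemma Ck_on_sum:
  assumes "open W" "finite I" "\<And>i. i \<in> I \<Longrightarrow> Ck_on k W (f i)"
  shows "Ck_on k W (\<lambda>x. \<Sum>i\<in>I. f i x)"
  using assms(2,3)
  by (induction I rule: finite_induct) (auto intro!: Ck_on_add Ck_on_const assms(1))

lemma Ck_on_inner:
  assumes "open W" "Ck_on k W f"
  shows "Ck_on k W (\<lambda>x. f x \<bullet> b)"
  using assms(2)
proof (induction k arbitrary: f)
  case 0
  then show ?case by (auto intro!: continuous_intros)
next
  case (Suc k)
  obtain f' where f': "\<And>x. x \<in> W \<Longrightarrow> (f has_derivative f' x) (at x)" "\<And>v. Ck_on k W (\<lambda>x. f' x v)"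
    using Ck_on_SucE[OF Suc.prems] by blast
  show ?case
    by (rule Ck_on_SucI[OF assms(1), where h' = "\<lambda>x v. f' x v \<bullet> b"])
      (use f' Suc.IH in \<open>auto intro: has_derivative_inner_left\<close>)
qed

text \<open>In the chain rule \<open>h' (f x) (f' x v)\<close> the argument of the linear map varies
  with \<open>x\<close>. Expanding it in the basis leaves a finite sum of products, and the
  induction hypothesis applies to \<open>h'\<close> in each fixed basis direction.\<close>

lemma Ck_on_compose:
  fixes f :: "'e::euclidean_space \<Rightarrow> 'f::euclidean_space" and h :: "'f \<Rightarrow> real"
  assumes "open W" "open V" "f ` W \<subseteq> V" "Ck_on k W f" "Ck_on k V h"
  shows "Ck_on k W (h \<circ> f)"
  using assms(4,5)
proof (induction k arbitrary: h)
  case 0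
  then show ?case using assms(3) continuous_on_compose2[of V h W f] by (simp add: o_def)
next
  case (Suc k)
  obtain f' where f': "\<And>x. x \<in> W \<Longrightarrow> (f has_derivative f' x) (at x)" "\<And>v. Ck_on k W (\<lambda>x. f' x v)"
    using Ck_on_SucE[OF Suc.prems(1)] by blast
  obtain h' where h': "\<And>x. x \<in> V \<Longrightarrow> (h has_derivative h' x) (at x)" "\<And>v. Ck_on k V (\<lambda>x. h' x v)"
    using Ck_on_SucE[OF Suc.prems(2)] by blast
  let ?d = "\<lambda>x v. \<Sum>b\<in>Basis. (f' x v \<bullet> b) * h' (f x) b"
  show ?case
  proof (rule Ck_on_SucI[OF assms(1), where h' = ?d])
    fix x assume x: "x \<in> W"
    then have fx: "f x \<in> V" using assms(3) by blast
    have lin: "linear (h' (f x))" using h'(1)[OF fx] has_derivative_linear by blast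
    have "h' (f x) (f' x v) = ?d x v" for v
    proof -
      have "h' (f x) (f' x v) = h' (f x) (\<Sum>b\<in>Basis. (f' x v \<bullet> b) *\<^sub>R b)"
        by (simp add: euclidean_representation)
      also have "\<dots> = ?d x v" using lin by (simp add: linear_sum linear_scale)
      finally show ?thesis .
    qed
    then have "h' (f x) \<circ> f' x = ?d x" by auto
    then show "(h \<circ> f has_derivative ?d x) (at x)"
      using diff_chain_at[OF f'(1)[OF x] h'(1)[OF fx]] by simp
  next
    fix v
    have "Ck_on k W (\<lambda>x. h' (f x) b)" for b
      using Suc.IH[OF Ck_on_SucD[OF Suc.prems(1)] h'(2)[of b]] by (simp add: o_def)
    then show "Ck_on k W (\<lambda>x. ?d x v)"
      by (intro Ck_on_sum Ck_on_mult Ck_on_inner assms(1) f'(2)) auto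
  qed
qed

section \<open>Charts and smooth real-valued functions\<close>

lemma smooth_atlas_chartD:
  assumes "smooth_atlas A" "(U, \<phi>) \<in> A"
  shows "open U" "homeomorphism U (\<phi> ` U) \<phi> (inv_into U \<phi>)" "open (\<phi> ` U)"
  using assms unfolding smooth_atlas_def by fast+

lemma open_chart_image:
  assumes "smooth_atlas A" "(U, \<phi>) \<in> A" "open W"
  shows "open (\<phi> ` (U \<inter> W))"
proof -
  note c = smooth_atlas_chartD[OF assms(1,2)]
  have "openin (top_of_set (\<phi> ` U)) (\<phi> ` (U \<inter> W))"
    using homeomorphism_imp_open_map[OF c(2)] assms(3) by (simp add: openin_open_Int)
  then show ?thesis using c(3) openin_open_trans by blast
qed

lemma inv_into_chart:
  assumes "smooth_atlas A" "(U, \<phi>) \<in> A" "x \<in> U"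
  shows "inv_into U \<phi> (\<phi> x) = x"
  using smooth_atlas_chartD(2)[OF assms(1,2)] assms(3) by (simp add: homeomorphism_def)

lemma smooth_fun_subset:
  assumes "smooth_fun A W f" "W' \<subseteq> W"
  shows "smooth_fun A W' f"
  unfolding smooth_fun_def Cinf_on_def
proof clarify
  fix U \<phi> k assume "(U, \<phi>) \<in> A"
  then have "Ck_on k (\<phi> ` (U \<inter> W)) (f \<circ> inv_into U \<phi>)"
    using assms(1) unfolding smooth_fun_def Cinf_on_def by blast
  then show "Ck_on k (\<phi> ` (U \<inter> W')) (f \<circ> inv_into U \<phi>)"
    by (rule Ck_on_subset) (use assms(2) in blast)
qed

lemma smooth_fun_cong_imp:
  assumes "smooth_atlas A" "open W" "smooth_fun A W f" "\<And>x. x \<in> W \<Longrightarrow> f x = h x"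
  shows "smooth_fun A W h"
  unfolding smooth_fun_def Cinf_on_def
proof clarify
  fix U \<phi> k assume c: "(U, \<phi>) \<in> A"
  show "Ck_on k (\<phi> ` (U \<inter> W)) (h \<circ> inv_into U \<phi>)"
  proof (rule Ck_on_cong_imp[of _ _ "f \<circ> inv_into U \<phi>"])
    show "Ck_on k (\<phi> ` (U \<inter> W)) (f \<circ> inv_into U \<phi>)"
      using assms(3) c unfolding smooth_fun_def Cinf_on_def by blast
    show "open (\<phi> ` (U \<inter> W))" by (rule open_chart_image[OF assms(1) c assms(2)])
  qed (auto simp: inv_into_chart[OF assms(1) c] assms(4))
qed

lemma smooth_fun_const:
  assumes "smooth_atlas A" "open W"
  shows "smooth_fun A W (\<lambda>_. c)"
  unfolding smooth_fun_def Cinf_on_def o_def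
proof clarify
  fix U \<phi> k assume "(U, \<phi>) \<in> A"
  from open_chart_image[OF assms(1) this assms(2)]
  show "Ck_on k (\<phi> ` (U \<inter> W)) (\<lambda>_. c)" by (rule Ck_on_const)
qed

lemma smooth_fun_add:
  assumes "smooth_atlas A" "open W" "smooth_fun A W f" "smooth_fun A W h"
  shows "smooth_fun A W (\<lambda>x. f x + h x)"
  using assms(3,4) unfolding smooth_fun_def Cinf_on_def o_def
  by (fastforce intro!: Ck_on_add open_chart_image[OF assms(1) _ assms(2)])

lemma smooth_fun_mult:
  assumes "smooth_atlas A" "open W" "smooth_fun A W f" "smooth_fun A W h"
  shows "smooth_fun A W (\<lambda>x. f x * h x)"
  using assms(3,4) unfolding smooth_fun_def Cinf_on_def o_def
  by (fastforce intro!: Ck_on_mult open_chart_image[OF assms(1) _ assms(2)])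

lemma smooth_fun_minus:
  assumes "smooth_atlas A" "open W" "smooth_fun A W f"
  shows "smooth_fun A W (\<lambda>x. - f x)"
  using smooth_fun_mult[OF assms(1,2) smooth_fun_const[OF assms(1,2), of "-1"] assms(3)] by simp

lemma smooth_nearI:
  "smooth_fun A W f \<Longrightarrow> open W \<Longrightarrow> p \<in> W \<Longrightarrow> smooth_near A p f"
  unfolding smooth_near_def by blast

lemma smooth_near_mult:
  assumes "smooth_atlas A" "smooth_near A p f" "smooth_near A p h"
  shows "smooth_near A p (\<lambda>x. f x * h x)"
proof -
  obtain W W' where "open W" "p \<in> W" "smooth_fun A W f" "open W'" "p \<in> W'" "smooth_fun A W' h"
    using assms(2,3) unfolding smooth_near_def by blast
  then show ?thesis
    by (intro smooth_nearI[of A "W \<inter> W'"] smooth_fun_mult assms(1))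
      (auto intro: smooth_fun_subset)
qed

lemma smooth_near_add:
  assumes "smooth_atlas A" "smooth_near A p f" "smooth_near A p h"
  shows "smooth_near A p (\<lambda>x. f x + h x)"
proof -
  obtain W W' where "open W" "p \<in> W" "smooth_fun A W f" "open W'" "p \<in> W'" "smooth_fun A W' h"
    using assms(2,3) unfolding smooth_near_def by blast
  then show ?thesis
    by (intro smooth_nearI[of A "W \<inter> W'"] smooth_fun_add assms(1))
      (auto intro: smooth_fun_subset)
qed

lemma smooth_near_const: "smooth_atlas A \<Longrightarrow> smooth_near A p (\<lambda>_. c)"
  by (rule smooth_nearI[of A UNIV]) (auto intro: smooth_fun_const)

lemma smooth_near_diff:
  assumes "smooth_atlas A" "smooth_near A p f" "smooth_near A p h"
  shows "smooth_near A p (\<lambda>x. f x - h x)"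
proof -
  have "smooth_near A p (\<lambda>x. f x + (-1) * h x)"
    by (intro smooth_near_add smooth_near_mult smooth_near_const assms)
  then show ?thesis by simp
qed

lemma smooth_near_cong_imp:
  assumes "smooth_atlas A" "smooth_near A p f" "open W" "p \<in> W" "\<And>x. x \<in> W \<Longrightarrow> f x = h x"
  shows "smooth_near A p h"
proof -
  obtain W' where "open W'" "p \<in> W'" "smooth_fun A W' f"
    using assms(2) unfolding smooth_near_def by blast
  then show ?thesis
    using assms(3-5)
    by (intro smooth_nearI[of A "W' \<inter> W"] smooth_fun_cong_imp[of A _ f h] assms(1))
      (auto intro: smooth_fun_subset)
qed

section \<open>Tangent vectors and vector fields\<close>

lemma tangent_space_cong:
  assumes "v \<in> tangent_space A p" "smooth_near A p f" "open W" "p \<in> W" "\<And>x. x \<in> W \<Longrightarrow> f x = h x"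
  shows "v f = v h"
  using assms unfolding tangent_space_def by blast

lemma tangent_nonsmooth: "v \<in> tangent_space A p \<Longrightarrow> \<not> smooth_near A p f \<Longrightarrow> v f = 0"
  by (simp add: tangent_space_def)

lemma tangent_plus:
  "v \<in> tangent_space A p \<Longrightarrow> smooth_near A p f \<Longrightarrow> smooth_near A p h
     \<Longrightarrow> v (\<lambda>x. f x + h x) = v f + v h"
  by (simp add: tangent_space_def)

lemma tangent_times:
  "v \<in> tangent_space A p \<Longrightarrow> smooth_near A p f \<Longrightarrow> smooth_near A p h
     \<Longrightarrow> v (\<lambda>x. f x * h x) = f p * v h + h p * v f"
  by (simp add: tangent_space_def)

lemma tangent_cmult:
  "v \<in> tangent_space A p \<Longrightarrow> smooth_near A p f \<Longrightarrow> v (\<lambda>x. c * f x) = c * v f"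
  by (simp add: tangent_space_def)

lemma tangent_space_add:
  assumes "u \<in> tangent_space A p" "v \<in> tangent_space A p"
  shows "u + v \<in> tangent_space A p"
proof -
  have loc: "(u + v) f = (u + v) h"
    if "smooth_near A p f" "open W" "p \<in> W" "\<forall>x\<in>W. f x = h x" for f h W
    using that tangent_space_cong[OF assms(1), of f W h] tangent_space_cong[OF assms(2), of f W h]
    by simp
  show ?thesis
    unfolding tangent_space_def mem_Collect_eq
    by (intro conjI allI impI; (elim conjE)?; (rule loc, assumption+)?)
      (simp_all add: algebra_simps assms[unfolded tangent_space_def mem_Collect_eq])
qed

lemma tangent_space_fscale:
  assumes "u \<in> tangent_space A p"
  shows "c *\<^sub>t u \<in> tangent_space A p"
proof -
  have loc: "(c *\<^sub>t u) f = (c *\<^sub>t u) h"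
    if "smooth_near A p f" "open W" "p \<in> W" "\<forall>x\<in>W. f x = h x" for f h W
    using that tangent_space_cong[OF assms, of f W h] by (simp add: fscale_def)
  show ?thesis
    unfolding tangent_space_def mem_Collect_eq
    by (intro conjI allI impI; (elim conjE)?; (rule loc, assumption+)?)
      (simp_all add: algebra_simps fscale_def assms[unfolded tangent_space_def mem_Collect_eq])
qed

lemma vector_field_tangent: "vector_field A W X \<Longrightarrow> p \<in> W \<Longrightarrow> X p \<in> tangent_space A p"
  by (simp add: vector_field_def)

lemma vector_field_smooth:
  "vector_field A U X \<Longrightarrow> open W \<Longrightarrow> W \<subseteq> U \<Longrightarrow> smooth_fun A W f \<Longrightarrow> smooth_fun A W (\<lambda>p. X p f)"
  by (simp add: vector_field_def)

lemma vector_field_subset: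
  assumes "vector_field A W X" "W' \<subseteq> W"
  shows "vector_field A W' X"
  unfolding vector_field_def
proof (intro conjI ballI allI impI; (elim conjE)?)
  fix p assume "p \<in> W'"
  then show "X p \<in> tangent_space A p"
    using assms(2) by (intro vector_field_tangent[OF assms(1)]) auto
next
  fix V f assume "open V" "V \<subseteq> W'" "smooth_fun A V f"
  then show "smooth_fun A V (\<lambda>p. X p f)"
    using assms(2) by (intro vector_field_smooth[OF assms(1)]) auto
qed

lemma vector_field_add:
  assumes "smooth_atlas A" "vector_field A W X" "vector_field A W Y"
  shows "vector_field A W (\<lambda>q. X q + Y q)"
  unfolding vector_field_def
proof (intro conjI ballI allI impI; (elim conjE)?)
  fix p assume "p \<in> W"
  then show "X p + Y p \<in> tangent_space A p"
    by (intro tangent_space_add vector_field_tangent[OF assms(2)] vector_field_tangent[OF assms(3)])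
next
  fix W' f assume "open W'" "W' \<subseteq> W" "smooth_fun A W' f"
  then show "smooth_fun A W' (\<lambda>p. (X p + Y p) f)"
    unfolding plus_fun_apply
    using vector_field_smooth[OF assms(2)] vector_field_smooth[OF assms(3)]
    by (simp add: smooth_fun_add[OF assms(1)])
qed

lemma vector_field_fscale:
  assumes "smooth_atlas A" "smooth_fun A W f" "vector_field A W X"
  shows "vector_field A W (\<lambda>q. f q *\<^sub>t X q)"
  unfolding vector_field_def
proof (intro conjI ballI allI impI; (elim conjE)?)
  fix p assume "p \<in> W"
  then show "f p *\<^sub>t X p \<in> tangent_space A p"
    by (intro tangent_space_fscale vector_field_tangent[OF assms(3)])
next
  fix W' h assume W': "open W'" "W' \<subseteq> W" "smooth_fun A W' h"
  have "smooth_fun A W' (\<lambda>p. f p * X p h)"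
    by (rule smooth_fun_mult[OF assms(1) W'(1) smooth_fun_subset[OF assms(2) W'(2)]
          vector_field_smooth[OF assms(3) W']])
  then show "smooth_fun A W' (\<lambda>p. (f p *\<^sub>t X p) h)" by (simp add: fscale_def)
qed

section \<open>The differential of a smooth map\<close>

text \<open>Read in charts, the function is the coordinate form of \<open>f\<close> after that of
  \<open>F\<close>, so \<open>Ck_on_compose\<close> applies.\<close>

lemma smooth_near_comp_map:
  fixes A :: "('m::{t2_space,second_countable_topology}, 'e::euclidean_space) atlas"
    and B :: "('k::{t2_space,second_countable_topology}, 'f::euclidean_space) atlas"
  assumes A: "smooth_atlas A" and B: "smooth_atlas B" and F: "smooth_map A B F"
    and f: "smooth_near B (F p) f"
  shows "smooth_near A p (f \<circ> F)"
proof -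
  obtain W where W: "open W" "F p \<in> W" "smooth_fun B W f"
    using f unfolding smooth_near_def by blast
  obtain V \<psi> where V: "(V, \<psi>) \<in> B" "F p \<in> V"
    using B unfolding smooth_atlas_def by blast
  note cB = smooth_atlas_chartD[OF B V(1)]
  have cont: "continuous_on UNIV F" using F unfolding smooth_map_def by blast
  \<comment> \<open>\<open>Q\<close> is small enough that the coordinate form of \<open>F\<close>
    maps into the coordinate domain on which \<open>f\<close> is smooth.\<close>
  define Q where "Q = F -` (V \<inter> W)"
  have Q: "open Q" "p \<in> Q"
    using cB(1) W V cont open_vimage[of "V \<inter> W" F] unfolding Q_def by auto
  have "smooth_fun A Q (f \<circ> F)"
    unfolding smooth_fun_def Cinf_on_def
  proof clarify
    fix U \<phi> k assume c: "(U, \<phi>) \<in> A"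
    let ?F = "\<psi> \<circ> F \<circ> inv_into U \<phi>" and ?f = "f \<circ> inv_into V \<psi>"
    have o: "open (\<phi> ` (U \<inter> Q))" by (rule open_chart_image[OF A c Q(1)])
    have "Ck_on k (\<phi> ` (U \<inter> F -` V)) ?F"
      using F c V(1) unfolding smooth_map_def Cinf_on_def by blast
    then have "Ck_on k (\<phi> ` (U \<inter> Q)) ?F"
      by (rule Ck_on_subset) (auto simp: Q_def)
    moreover have "Ck_on k (\<psi> ` (V \<inter> W)) ?f"
      using W(3) V(1) unfolding smooth_fun_def Cinf_on_def by blast
    moreover have "?F ` (\<phi> ` (U \<inter> Q)) \<subseteq> \<psi> ` (V \<inter> W)"
      by (auto simp: inv_into_chart[OF A c] Q_def)
    ultimately have "Ck_on k (\<phi> ` (U \<inter> Q)) (?f \<circ> ?F)"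
      by (intro Ck_on_compose[OF o open_chart_image[OF B V(1) W(1)]])
    then show "Ck_on k (\<phi> ` (U \<inter> Q)) (f \<circ> F \<circ> inv_into U \<phi>)"
      by (rule Ck_on_cong_imp[OF _ o])
        (auto simp: inv_into_chart[OF A c] inv_into_chart[OF B V(1)] Q_def)
  qed
  then show ?thesis using Q smooth_nearI by blast
qed

text \<open>Composition with \<open>F\<close> turns each law of a derivation at \<open>F p\<close>
  into the same law for \<open>v\<close>. Sums and products need their own smoothness check, since
  \<open>differential\<close> is 0 on nonsmooth functions.\<close>

lemma differential_tangent:
  fixes A :: "('m::{t2_space,second_countable_topology}, 'e::euclidean_space) atlas"
    and B :: "('k::{t2_space,second_countable_topology}, 'f::euclidean_space) atlas"
  assumes A: "smooth_atlas A" and B: "smooth_atlas B" and F: "smooth_map A B F"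
    and v: "v \<in> tangent_space A p"
  shows "differential B F p v \<in> tangent_space B (F p)"
proof -
  note c = smooth_near_comp_map[OF A B F]
  have cont: "continuous_on UNIV F" using F unfolding smooth_map_def by blast
  have loc: "differential B F p v f = differential B F p v h"
    if "smooth_near B (F p) f" "open W" "F p \<in> W" "\<forall>x\<in>W. f x = h x" for f h W
  proof -
    \<comment> \<open>Otherwise the right-hand side would be the default value 0.\<close>
    have h: "smooth_near B (F p) h" using smooth_near_cong_imp[OF B that(1-3)] that(4) by blast
    have "open (F -` W)" using cont that(2) open_vimage by blast
    then have "v (f \<circ> F) = v (h \<circ> F)"
      using that(3,4) by (intro tangent_space_cong[OF v c[OF that(1)], of "F -` W"]) auto
    then show ?thesis using that(1) h by (simp add: differential_def)
  qed
  show ?thesis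
    unfolding tangent_space_def
  proof (intro CollectI conjI allI impI; (elim conjE)?)
    fix f h assume fh: "smooth_near B (F p) f" "smooth_near B (F p) h"
    show "differential B F p v (\<lambda>x. f x + h x) = differential B F p v f + differential B F p v h"
      using fh tangent_plus[OF v c[OF fh(1)] c[OF fh(2)]] smooth_near_add[OF B fh]
      by (simp add: differential_def o_def)
    show "differential B F p v (\<lambda>x. f x * h x)
        = f (F p) * differential B F p v h + h (F p) * differential B F p v f"
      using fh tangent_times[OF v c[OF fh(1)] c[OF fh(2)]] smooth_near_mult[OF B fh]
      by (simp add: differential_def o_def)
  next
    fix a f assume f: "smooth_near B (F p) f"
    show "differential B F p v (\<lambda>x. a * f x) = a * differential B F p v f"
      using f tangent_cmult[OF v c[OF f]] smooth_near_mult[OF B smooth_near_const[OF B] f]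
      by (simp add: differential_def o_def)
  qed (use loc in \<open>auto simp: differential_def\<close>)
qed

lemma differential_add: "differential B F p (u + v) = differential B F p u + differential B F p v"
  by (simp add: differential_def fun_eq_iff)

lemma differential_fscale: "differential B F p (c *\<^sub>t u) = c *\<^sub>t differential B F p u"
  by (simp add: differential_def fscale_def fun_eq_iff)

section \<open>Smoothness of the degenerate metric\<close>

text \<open>The algebraic half of \<open>sym_tensor2\<close>. It passes to the induced metric point
  by point, whereas the smoothness half would call for extending fields to the ambient
  manifold.\<close>

definition sym_bilinear_on ::
  "('m::{t2_space,second_countable_topology}, 'e::euclidean_space) atlas
     \<Rightarrow> 'm set \<Rightarrow> 'm tensor2 \<Rightarrow> bool" where
  "sym_bilinear_on A U h \<longleftrightarrow>
     (\<forall>p\<in>U. \<forall>u\<in>tangent_space A p. \<forall>v\<in>tangent_space A p. \<forall>w\<in>tangent_space A p. \<forall>c.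
        h p u v = h p v u \<and> h p (u + v) w = h p u w + h p v w \<and> h p (c *\<^sub>t u) w = c * h p u w)"

lemma sym_tensor2_bilinear: "sym_tensor2 A U h \<Longrightarrow> sym_bilinear_on A U h"
  unfolding sym_tensor2_def sym_bilinear_on_def by (rule conjunct1)

lemma sym_bilinear_on_subset: "sym_bilinear_on A U h \<Longrightarrow> W \<subseteq> U \<Longrightarrow> sym_bilinear_on A W h"
  unfolding sym_bilinear_on_def by (simp add: subset_iff)

context
  fixes A :: "('m::{t2_space,second_countable_topology}, 'e::euclidean_space) atlas"
    and U :: "'m set" and h :: "'m tensor2" and p :: 'm
  assumes h: "sym_bilinear_on A U h" and p: "p \<in> U"
begin

lemma sym_bilinear_sym:
  "u \<in> tangent_space A p \<Longrightarrow> v \<in> tangent_space A p \<Longrightarrow> h p u v = h p v u"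
  using h p unfolding sym_bilinear_on_def by simp

lemma sym_bilinear_add_left:
  "u \<in> tangent_space A p \<Longrightarrow> v \<in> tangent_space A p \<Longrightarrow> w \<in> tangent_space A p
     \<Longrightarrow> h p (u + v) w = h p u w + h p v w"
  using h p unfolding sym_bilinear_on_def by simp

lemma sym_bilinear_fscale_left:
  "u \<in> tangent_space A p \<Longrightarrow> w \<in> tangent_space A p \<Longrightarrow> h p (c *\<^sub>t u) w = c * h p u w"
  using h p unfolding sym_bilinear_on_def by simp

lemma sym_bilinear_add_right:
  "u \<in> tangent_space A p \<Longrightarrow> v \<in> tangent_space A p \<Longrightarrow> w \<in> tangent_space A p
     \<Longrightarrow> h p w (u + v) = h p w u + h p w v"
  by (simp add: sym_bilinear_sym[of w] tangent_space_add sym_bilinear_add_left)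

lemma sym_bilinear_fscale_right:
  "u \<in> tangent_space A p \<Longrightarrow> w \<in> tangent_space A p \<Longrightarrow> h p w (c *\<^sub>t u) = c * h p w u"
  by (simp add: sym_bilinear_sym[of w] tangent_space_fscale sym_bilinear_fscale_left)

end

lemma induced_metric_bilinear:
  fixes A :: "('m::{t2_space,second_countable_topology}, 'e::euclidean_space) atlas"
    and B :: "('k::{t2_space,second_countable_topology}, 'f::euclidean_space) atlas"
  assumes "smooth_atlas A" "smooth_atlas B" "smooth_map A B F" "sym_bilinear_on B UNIV h"
  shows "sym_bilinear_on A UNIV (induced_metric B F h)"
  unfolding sym_bilinear_on_def induced_metric_def
  by (intro ballI allI conjI)
    (simp_all add: differential_add differential_fscale differential_tangent[OF assms(1-3)]
      sym_bilinear_sym[OF assms(4) UNIV_I] sym_bilinear_add_left[OF assms(4) UNIV_I]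
      sym_bilinear_fscale_left[OF assms(4) UNIV_I])

lemma conformal_class_scaling:
  assumes "g \<in> conformal_class A g\<^sub>0"
  obtains f where "\<And>p u v. u \<in> tangent_space A p \<Longrightarrow> v \<in> tangent_space A p
      \<Longrightarrow> g p u v = exp (-2 * f p) * g\<^sub>0 p u v"
  using assms unfolding conformal_class_def by blast

lemma conformal_class_bilinear:
  assumes "g \<in> conformal_class A g\<^sub>0" "sym_bilinear_on A UNIV g\<^sub>0"
  shows "sym_bilinear_on A UNIV g"
proof -
  obtain f where f: "\<And>p u v. u \<in> tangent_space A p \<Longrightarrow> v \<in> tangent_space A p
      \<Longrightarrow> g p u v = exp (-2 * f p) * g\<^sub>0 p u v"
    using conformal_class_scaling[OF assms(1)] by metis
  show ?thesis
    unfolding sym_bilinear_on_def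
    by (intro ballI allI conjI)
      (simp_all add: f tangent_space_add tangent_space_fscale distrib_left
        sym_bilinear_add_left[OF assms(2) UNIV_I] sym_bilinear_fscale_left[OF assms(2) UNIV_I]
        sym_bilinear_add_right[OF assms(2) UNIV_I] sym_bilinear_fscale_right[OF assms(2) UNIV_I]
        sym_bilinear_sym[OF assms(2) UNIV_I])
qed

text \<open>The conformal factor is an exponential and never 0. This lets the screen of the original
  metric serve for \<open>g\<close>.\<close>

lemma Rad_conformal_class:
  assumes "g \<in> conformal_class A g\<^sub>0"
  shows "Rad A g p = Rad A g\<^sub>0 p"
proof -
  obtain f where "\<And>p u v. u \<in> tangent_space A p \<Longrightarrow> v \<in> tangent_space A p
      \<Longrightarrow> g p u v = exp (-2 * f p) * g\<^sub>0 p u v"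
    using conformal_class_scaling[OF assms] by metis
  then show ?thesis unfolding Rad_def by auto
qed

lemma screen_distribution_conformal_class:
  "g \<in> conformal_class A g\<^sub>0 \<Longrightarrow> screen_distribution A n g\<^sub>0 S \<Longrightarrow> screen_distribution A n g S"
  unfolding screen_distribution_def by (simp add: Rad_conformal_class)

section \<open>Rules for linear connections\<close>

context
  fixes A :: "('m::{t2_space,second_countable_topology}, 'e::euclidean_space) atlas"
    and U :: "'m set" and D :: "'m connection" and W :: "'m set" and Y :: "'m vfield"
  assumes D: "linear_connection A U D" and W: "open W" "W \<subseteq> U" and Y: "vector_field A W Y"
begin

private lemmas D' = D[unfolded linear_connection_def, rule_format, OF conjI[OF W(1) conjI[OF W(2) Y]]]

lemma connection_field: "vector_field A W X \<Longrightarrow> vector_field A W (\<lambda>p. D p (X p) Y)"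
  using D' by blast

context
  fixes p v
  assumes p: "p \<in> W" and v: "v \<in> tangent_space A p"
begin

private lemmas D'' = D'[THEN conjunct2, rule_format, OF p v]

lemma connection_tangent: "D p v Y \<in> tangent_space A p"
  by (rule D''[THEN conjunct1])

lemma connection_add:
  "vector_field A W Y' \<Longrightarrow> D p v (\<lambda>q. Y q + Y' q) = D p v Y + D p v Y'"
  by (rule D''[THEN conjunct2, THEN conjunct2, THEN conjunct2, THEN conjunct1, rule_format])

lemma connection_leibniz:
  "smooth_fun A W f \<Longrightarrow> D p v (\<lambda>q. f q *\<^sub>t Y q) = v f *\<^sub>t Y p + f p *\<^sub>t D p v Y"
  by (rule D''[THEN conjunct2, THEN conjunct2, THEN conjunct2, THEN conjunct2, THEN conjunct1,
        rule_format])

lemma connection_cong: "(\<And>q. q \<in> W \<Longrightarrow> Y' q = Y q) \<Longrightarrow> D p v Y' = D p v Y"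
  by (rule D''[THEN conjunct2, THEN conjunct2, THEN conjunct2, THEN conjunct2, THEN conjunct2,
        rule_format]) blast

end
end

section \<open>Smoothness of the metric from its compatible connection\<close>

text \<open>The Leibniz rule for 1 = 1 * 1 makes the derivative of 1 equal to twice itself;
  homogeneity does the rest.\<close>

lemma tangent_space_const:
  assumes "smooth_atlas A" "v \<in> tangent_space A p"
  shows "v (\<lambda>_. c) = 0"
proof -
  have s: "smooth_near A p (\<lambda>_. c)" for c by (rule smooth_near_const[OF assms(1)])
  have "v (\<lambda>_. 1) = 0" using tangent_times[OF assms(2) s[of 1] s[of 1]] by simp
  then show ?thesis using tangent_cmult[OF assms(2) s[of 1]] by simp
qed

text \<open>A tangent vector kills every function that is not smooth near its base point. Hence if
  \<open>g(Y, Z)\<close> were not smooth, then comparing the compatibility condition for \<open>Y\<close> and for \<open>hY\<close> would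
  give \<open>v(h) g(Y, Z) = 0\<close>.\<close>

lemma metric_smooth_near_nonzero:
  assumes A: "smooth_atlas A" and D: "linear_connection A U D" "metric_connection A U D g"
    and g: "sym_bilinear_on A U g" and W: "open W" "W \<subseteq> U" "p \<in> W"
    and Y: "vector_field A W Y" and Z: "vector_field A W Z"
    and v: "v \<in> tangent_space A p" "v \<noteq> 0" and nz: "g p (Y p) (Z p) \<noteq> 0"
  shows "smooth_near A p (\<lambda>q. g q (Y q) (Z q))"
proof (rule ccontr)
  let ?f = "\<lambda>q. g q (Y q) (Z q)"
  assume ns: "\<not> smooth_near A p ?f"
  note null = tangent_nonsmooth[OF v(1)]
  \<comment> \<open>A tangent vector is a function on functions, so being nonzero means not killing
    some \<open>h\<close>; by \<open>null\<close> this \<open>h\<close> is smooth near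
    \<open>p\<close>.\<close>
  obtain h where vh: "v h \<noteq> 0" using v(2) by (auto simp: fun_eq_iff)
  then have h: "smooth_near A p h" by (metis null)
  then obtain V where V: "open V" "p \<in> V" "smooth_fun A V h"
    unfolding smooth_near_def by blast
  let ?W = "W \<inter> V"
  have W': "open ?W" "?W \<subseteq> U" "p \<in> ?W" using V W by auto
  have YW: "vector_field A ?W Y" and ZW: "vector_field A ?W Z"
    by (rule vector_field_subset[OF Y], simp) (rule vector_field_subset[OF Z], simp)
  have pU: "p \<in> U" using W by blast
  have tYZ: "Y q \<in> tangent_space A q" "Z q \<in> tangent_space A q" if "q \<in> W" for q
    using that by (rule vector_field_tangent[OF Y], rule vector_field_tangent[OF Z])
  have compat: "v (\<lambda>q. g q (Y' q) (Z q)) = g p (D p v Y') (Z p) + g p (Y' p) (D p v Z)"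
    if "vector_field A ?W Y'" for Y'
    using D(2)[unfolded metric_connection_def, rule_format, of ?W Y' Z p v] that ZW W' v(1)
    by (simp add: cov_deriv2_def)
  \<comment> \<open>Claimed for every constant \<open>c\<close> because two values of
    \<open>c\<close> are compared at the end; adding \<open>c\<close> does not change
    \<open>v h\<close>.\<close>
  have smooth: "smooth_near A p (\<lambda>q. (h q + c) * ?f q)" for c
  proof (rule ccontr)
    let ?h = "\<lambda>q. h q + c"
    assume ns': "\<not> smooth_near A p (\<lambda>q. ?h q * ?f q)"
    have hW: "smooth_fun A ?W ?h"
      using V(3) W' by (intro smooth_fun_add smooth_fun_const A) (auto intro: smooth_fun_subset)
    have f': "g q (?h q *\<^sub>t Y q) (Z q) = ?h q * ?f q" if "q \<in> ?W" for q
      using that W(2) tYZ[of q] by (auto intro: sym_bilinear_fscale_left[OF g])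
    have "\<not> smooth_near A p (\<lambda>q. g q (?h q *\<^sub>t Y q) (Z q))"
    proof
      assume "smooth_near A p (\<lambda>q. g q (?h q *\<^sub>t Y q) (Z q))"
      then have "smooth_near A p (\<lambda>q. ?h q * ?f q)"
        by (rule smooth_near_cong_imp[OF A _ W'(1,3) f'])
      with ns' show False ..
    qed
    \<comment> \<open>The left side is \<open>v\<close> applied to a function that is not smooth
      near \<open>p\<close>.\<close>
    then have "0 = g p (D p v (\<lambda>q. ?h q *\<^sub>t Y q)) (Z p) + g p (?h p *\<^sub>t Y p) (D p v Z)"
      using compat[OF vector_field_fscale[OF A hW YW]] null by simp
    also have "D p v (\<lambda>q. ?h q *\<^sub>t Y q) = v ?h *\<^sub>t Y p + ?h p *\<^sub>t D p v Y"
      by (rule connection_leibniz[OF D(1) W'(1,2) YW W'(3) v(1) hW])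
    also have "v ?h = v h"
    proof -
      have "v ?h = v h + v (\<lambda>_. c)"
        by (rule tangent_plus[OF v(1) h smooth_near_const[OF A]])
      then show ?thesis using tangent_space_const[OF A v(1)] by simp
    qed
    also have "g p (v h *\<^sub>t Y p + ?h p *\<^sub>t D p v Y) (Z p) + g p (?h p *\<^sub>t Y p) (D p v Z)
        = v h * ?f p + ?h p * (g p (D p v Y) (Z p) + g p (Y p) (D p v Z))"
      using tYZ[OF W(3)] connection_tangent[OF D(1) W'(1,2) YW W'(3) v(1)]
        connection_tangent[OF D(1) W'(1,2) ZW W'(3) v(1)]
      by (simp only: sym_bilinear_fscale_left[OF g pU] sym_bilinear_add_left[OF g pU]
          tangent_space_fscale distrib_left add.assoc)
    \<comment> \<open>Here \<open>?f\<close> itself is the nonsmooth function, so its derivative has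
      the default value 0. Only \<open>v h * ?f p\<close> is left, a product of nonzero
      numbers.\<close>
    also have "g p (D p v Y) (Z p) + g p (Y p) (D p v Z) = 0"
      using compat[OF YW] null[OF ns] by simp
    finally show False using vh nz by simp
  qed
  \<comment> \<open>With \<open>c\<close> equal to 1 and 0 the difference is
    \<open>?f\<close>.\<close>
  have "smooth_near A p (\<lambda>q. (h q + 1) * ?f q - (h q + 0) * ?f q)"
    by (rule smooth_near_diff[OF A smooth smooth])
  then show False using ns by (simp add: algebra_simps)
qed

text \<open>A nonzero frame vector lies in the screen, hence outside the radical, and pairs
  nontrivially with some \<open>w\<close>. The radical part of \<open>w\<close> contributes nothing,
  and its screen part is a combination of the frame.\<close>

lemma screen_frame_nondegenerate:
  assumes g: "sym_bilinear_on A UNIV g"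
    and S: "S p = fun_vs.span ((\<lambda>i. E i p) ` {..<n})" "fun_vs.dim (S p) = n" "0 < n"
    and E: "\<And>i. i < n \<Longrightarrow> E i p \<in> tangent_space A p"
    and split: "S p \<inter> Rad A g p = {0}" "{u + w |u w. u \<in> S p \<and> w \<in> Rad A g p} = tangent_space A p"
  obtains i j where "i < n" "j < n" "g p (E i p) (E j p) \<noteq> 0"
proof -
  \<comment> \<open>If all frame vectors vanished, the screen would lie in the span of the empty set
    and have dimension 0.\<close>
  have "\<exists>i<n. E i p \<noteq> 0"
  proof (rule ccontr)
    assume "\<not> ?thesis"
    then have "(\<lambda>i. E i p) ` {..<n} \<subseteq> {0}" by auto
    then have "S p \<subseteq> fun_vs.span {0}" unfolding S(1) by (rule fun_vs.span_mono)
    then have "S p \<subseteq> fun_vs.span {}" by (simp add: fun_vs.span_insert_0)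
    then have "fun_vs.dim (S p) \<le> card ({} :: 'a tangent set)"
      by (rule fun_vs.dim_le_card) simp
    then show False using S(2,3) by simp
  qed
  then obtain i where i: "i < n" "E i p \<noteq> 0" by blast
  then have "E i p \<in> S p" unfolding S(1) by (auto intro: fun_vs.span_base)
  then have "E i p \<notin> Rad A g p" using split(1) i(2) by blast
  then obtain w where w: "w \<in> tangent_space A p" "g p (E i p) w \<noteq> 0"
    using E[OF i(1)] unfolding Rad_def by blast
  then obtain u r where ur: "w = u + r" "u \<in> S p" "r \<in> Rad A g p"
    using split(2) by blast
  have r: "r \<in> tangent_space A p" "g p r (E i p) = 0"
    using ur(3) E[OF i(1)] unfolding Rad_def by blast+
  have "\<exists>j<n. g p (E i p) (E j p) \<noteq> 0"
  proof (rule ccontr)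
    assume "\<not> ?thesis"
    then have z: "g p (E i p) (E j p) = 0" if "j < n" for j using that by blast
    have zero: "0 \<in> tangent_space A p \<and> g p (E i p) 0 = 0"
      using tangent_space_fscale[OF E[OF i(1)], of 0]
        sym_bilinear_fscale_right[OF g UNIV_I E[OF i(1)] E[OF i(1)], of 0]
      by simp
    have "u \<in> fun_vs.span ((\<lambda>i. E i p) ` {..<n})" using ur(2) S(1) by simp
    \<comment> \<open>Tangency is carried through the induction because bilinearity is available on
      tangent vectors only.\<close>
    then have "u \<in> tangent_space A p \<and> g p (E i p) u = 0"
    proof (induction rule: fun_vs.span_induct_alt)
      case base
      then show ?case by (rule zero)
    next
      case (step c e y)
      then obtain j where "j < n" "e = E j p" by blast
      then show ?case
        using step z E[OF i(1)] E
        by (simp del: plus_fun_apply add: tangent_space_add tangent_space_fscale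
            sym_bilinear_add_right[OF g UNIV_I] sym_bilinear_fscale_right[OF g UNIV_I])
    qed
    then have "g p (E i p) w = 0"
      using r E[OF i(1)]
      by (simp add: ur(1) sym_bilinear_add_right[OF g UNIV_I] sym_bilinear_sym[OF g UNIV_I, of _ _ r])
    then show False using w(2) by blast
  qed
  then show ?thesis using i(1) that by blast
qed

text \<open>Where \<open>g(Y, Z)\<close> vanishes, \<open>Y\<close> and \<open>Z\<close> are perturbed by members of a local frame of the screen
  distribution to reduce to the nonvanishing case.\<close>

lemma metric_smooth_near:
  assumes A: "smooth_atlas A" and D: "linear_connection A U D" "metric_connection A U D g"
    and g: "sym_bilinear_on A UNIV g" and screen: "screen_distribution A n g S"
    and W: "open W" "W \<subseteq> U" "p \<in> W"
    and Y: "vector_field A W Y" and Z: "vector_field A W Z"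
    and v: "v \<in> tangent_space A p" "v \<noteq> 0"
  shows "smooth_near A p (\<lambda>q. g q (Y q) (Z q))"
proof -
  obtain V E where V: "open V" "p \<in> V" and E: "\<And>i. i < n \<Longrightarrow> vector_field A V (E i)"
    and S: "\<And>q. q \<in> V \<Longrightarrow> S q = fun_vs.span ((\<lambda>i. E i q) ` {..<n})"
      "\<And>q. q \<in> V \<Longrightarrow> fun_vs.dim (S q) = n"
    using screen unfolding screen_distribution_def smooth_distribution_def by metis
  have split: "S q \<inter> Rad A g q = {0}"
    "{u + w |u w. u \<in> S q \<and> w \<in> Rad A g q} = tangent_space A q" for q
    using screen by (simp_all add: screen_distribution_def)
  let ?W = "W \<inter> V"
  have W': "open ?W" "?W \<subseteq> U" "p \<in> ?W" using V W by auto
  let ?s = "\<lambda>Y Z. smooth_near A p (\<lambda>q. g q (Y q) (Z q))"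
  have gU: "sym_bilinear_on A U g" using g sym_bilinear_on_subset by blast
  note nonzero = metric_smooth_near_nonzero[OF A D gU W' _ _ v]
  have commute: "?s Z Y" if "?s Y Z" "vector_field A ?W Y" "vector_field A ?W Z" for Y Z
    by (rule smooth_near_cong_imp[OF A that(1) W'(1,3)], rule sym_bilinear_sym[OF g UNIV_I])
      (auto intro: vector_field_tangent[OF that(2)] vector_field_tangent[OF that(3)])
  have diff: "?s Y Z" if "?s (\<lambda>q. Y q + e q) Z" "?s e Z"
      "vector_field A ?W Y" "vector_field A ?W Z" "vector_field A ?W e" for Y Z e
    by (rule smooth_near_cong_imp[OF A smooth_near_diff[OF A that(1,2)] W'(1,3)])
      (simp add: sym_bilinear_add_left[OF g UNIV_I] vector_field_tangent[OF that(3)]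
        vector_field_tangent[OF that(4)] vector_field_tangent[OF that(5)])
  \<comment> \<open>If \<open>Y\<close> and \<open>Z\<close> pair to 0 at \<open>p\<close>, then
    \<open>Y + e\<close> and \<open>Z\<close> do not; the pairings of \<open>Y + e\<close> and of
    \<open>e\<close> with \<open>Z\<close> are smooth, hence so is their difference.\<close>
  have left: "?s Y Z" if Y: "vector_field A ?W Y" and Z: "vector_field A ?W Z"
      and e: "vector_field A ?W e" "g p (e p) (Z p) \<noteq> 0" for Y Z e
  proof (cases "g p (Y p) (Z p) = 0")
    case True
    then have "g p (Y p + e p) (Z p) \<noteq> 0"
      using e(2) vector_field_tangent[OF Y W'(3)] vector_field_tangent[OF Z W'(3)]
        vector_field_tangent[OF e(1) W'(3)] by (simp add: sym_bilinear_add_left[OF g UNIV_I])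
    then have "?s (\<lambda>q. Y q + e q) Z" using nonzero[OF vector_field_add[OF A Y e(1)] Z] by simp
    then show ?thesis by (rule diff[OF _ nonzero[OF e(1) Z e(2)] Y Z e(1)])
  qed (rule nonzero[OF Y Z])
  have right: "?s Y Z" if Y: "vector_field A ?W Y" and Z: "vector_field A ?W Z"
      and e: "vector_field A ?W e" "g p (Y p) (e p) \<noteq> 0" for Y Z e
    using left[OF Z Y e(1)] commute[OF _ Z Y] e(2) sym_bilinear_sym[OF g UNIV_I]
      vector_field_tangent[OF Y W'(3)] vector_field_tangent[OF e(1) W'(3)] by simp
  have YW: "vector_field A ?W Y" and ZW: "vector_field A ?W Z"
    by (rule vector_field_subset[OF Y], simp) (rule vector_field_subset[OF Z], simp)
  have EW: "vector_field A ?W (E i)" if "i < n" for i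
    by (rule vector_field_subset[OF E[OF that]]) simp
  show ?thesis
  proof (cases "n = 0")
    case True
    \<comment> \<open>A screen of rank 0 makes the whole tangent space radical, so there is no frame
      to perturb with and \<open>g\<close> vanishes.\<close>
    have "g q (Y q) (Z q) = 0" if "q \<in> ?W" for q
    proof -
      have "S q = {0}" using S(1)[of q] that True by simp
      then have "tangent_space A q \<subseteq> Rad A g q" using split(2)[of q] by auto
      then have "Y q \<in> Rad A g q" using vector_field_tangent[OF YW that] by blast
      then show ?thesis using vector_field_tangent[OF ZW that] unfolding Rad_def by blast
    qed
    then show ?thesis
      using smooth_near_cong_imp[OF A smooth_near_const[OF A, of p 0] W'(1,3)] by simp
  next
    case False
    then have "0 < n" by simp
    then obtain i j where ij: "i < n" "j < n" "g p (E i p) (E j p) \<noteq> 0"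
      by (rule screen_frame_nondegenerate[where E = E and S = S,
          OF g S(1)[OF V(2)] S(2)[OF V(2)] _ vector_field_tangent[OF E V(2)] split])
    \<comment> \<open>One of \<open>Y\<close> and \<open>Y + E i\<close> pairs nontrivially with
      \<open>E j\<close> at \<open>p\<close>, and so does \<open>E i\<close>; each field that does
      has a smooth pairing with \<open>Z\<close> by \<open>right\<close>.\<close>
    show ?thesis
    proof (cases "g p (Y p) (E j p) = 0")
      case True
      then have "g p (Y p + E i p) (E j p) \<noteq> 0"
        using ij(3) vector_field_tangent[OF YW W'(3)] vector_field_tangent[OF EW W'(3)] ij
        by (simp add: sym_bilinear_add_left[OF g UNIV_I])
      then have "?s (\<lambda>q. Y q + E i q) Z"
        using right[OF vector_field_add[OF A YW EW[OF ij(1)]] ZW EW[OF ij(2)]] by simp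
      then show ?thesis
        by (rule diff[OF _ right[OF EW[OF ij(1)] ZW EW[OF ij(2)] ij(3)] YW ZW EW[OF ij(1)]])
    qed (rule right[OF YW ZW EW[OF ij(2)]])
  qed
qed

section \<open>Curvature of a Weyl connection\<close>

lemma one_form_smooth:
  "one_form A U \<omega> \<Longrightarrow> open W \<Longrightarrow> W \<subseteq> U \<Longrightarrow> vector_field A W X \<Longrightarrow> smooth_fun A W (\<lambda>p. \<omega> p (X p))"
  by (simp add: one_form_def)

lemma one_form_add:
  "one_form A U \<omega> \<Longrightarrow> p \<in> U \<Longrightarrow> u \<in> tangent_space A p \<Longrightarrow> v \<in> tangent_space A p
     \<Longrightarrow> \<omega> p (u + v) = \<omega> p u + \<omega> p v"
  by (simp add: one_form_def)

lemma one_form_fscale: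
  "one_form A U \<omega> \<Longrightarrow> p \<in> U \<Longrightarrow> u \<in> tangent_space A p \<Longrightarrow> \<omega> p (c *\<^sub>t u) = c * \<omega> p u"
  by (simp add: one_form_def)

lemma sym_tensor2_smooth:
  "sym_tensor2 A U h \<Longrightarrow> open W \<Longrightarrow> W \<subseteq> U \<Longrightarrow> vector_field A W X \<Longrightarrow> vector_field A W Y
     \<Longrightarrow> smooth_fun A W (\<lambda>p. h p (X p) (Y p))"
  by (simp add: sym_tensor2_def)

lemma metric_connectionD:
  assumes "metric_connection A U D h" "open W" "W \<subseteq> U" "vector_field A W Y" "vector_field A W Z"
    "p \<in> W" "v \<in> tangent_space A p"
  shows "v (\<lambda>q. h q (Y q) (Z q)) = h p (D p v Y) (Z p) + h p (Y p) (D p v Z)"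
  using assms(1)[unfolded metric_connection_def, rule_format, of W Y Z p v] assms(2-)
  by (simp add: cov_deriv2_def)

text \<open>The difference is written with the scalar -1 so that additivity and homogeneity of
  tensors apply to the bracket directly.\<close>

lemma torsion_freeD:
  assumes "torsion_free A U D" "open W" "W \<subseteq> U" "vector_field A W X" "vector_field A W Y" "p \<in> W"
  shows "lie_bracket A X Y p = D p (X p) Y + (-1) *\<^sub>t D p (Y p) X"
  using assms(1)[unfolded torsion_free_def, rule_format, of W X Y p, symmetric] assms(2-)
  by (simp add: fun_eq_iff fscale_def)

text \<open>Signs are moved into the coefficients: the result is a sum of multiples of fields, ready
  for the Leibniz rule.\<close>

lemma theta_tilde_eq_sum:
  "x + theta_tilde g \<theta> \<theta>s T \<xi> p y z
     = x + \<theta> p y *\<^sub>t z + \<theta> p z *\<^sub>t y + (- g p y z) *\<^sub>t \<theta>s p + (- T p y z) *\<^sub>t \<xi> p"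
  by (simp add: theta_tilde_def fun_eq_iff fscale_def)

lemma wedge_term_eq_sum:
  "wedge_term g D \<theta> \<theta>s X p
     = D p (X p) \<theta>s + (- \<theta> p (X p)) *\<^sub>t \<theta>s p + (1/2 * g p (\<theta>s p) (\<theta>s p)) *\<^sub>t X p"
  by (simp add: wedge_term_def fun_eq_iff fscale_def)

section \<open>Second derivatives under the Weyl connection\<close>

context
  fixes A :: "('m::{t2_space,second_countable_topology}, 'e::euclidean_space) atlas"
    and g T :: "'m tensor2" and D Dg :: "'m connection" and U :: "'m set"
    and \<xi> \<theta>s :: "'m vfield" and \<theta> \<phi> :: "'m form"
  assumes A: "smooth_atlas A"
    and D: "linear_connection A UNIV D" and Dg: "linear_connection A U Dg"
    and \<theta>: "one_form A UNIV \<theta>" and T: "sym_tensor2 A U T"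
    and \<theta>s: "vector_field A U \<theta>s" and \<xi>: "vector_field A U \<xi>"
    and D_Dg: "\<forall>W X Y. open W \<and> W \<subseteq> U \<and> vector_field A W X \<and> vector_field A W Y \<longrightarrow>
      (\<forall>p\<in>W. D p (X p) Y = Dg p (X p) Y + theta_tilde g \<theta> \<theta>s T \<xi> p (X p) (Y p))"
begin

lemma weyl_connection_eq:
  "open W \<Longrightarrow> W \<subseteq> U \<Longrightarrow> vector_field A W X \<Longrightarrow> vector_field A W Y \<Longrightarrow> p \<in> W
    \<Longrightarrow> D p (X p) Y = Dg p (X p) Y + theta_tilde g \<theta> \<theta>s T \<xi> p (X p) (Y p)"
  by (rule D_Dg[rule_format, OF conjI[OF _ conjI[OF _ conjI]]])

text \<open>\<open>D_Y Z\<close> is a sum of five fields, four of them with function coefficients.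
  The outer derivative is again \<open>Dg\<close> plus \<open>theta_tilde\<close>, and the Leibniz
  rule for \<open>Dg\<close> treats each summand; this is where \<open>gYZ\<close> enters.\<close>

lemma weyl_second_derivative:
  assumes W: "open W" "W \<subseteq> U" and X: "vector_field A W X" and Y: "vector_field A W Y"
    and Z: "vector_field A W Z" and gYZ: "smooth_fun A W (\<lambda>q. g q (Y q) (Z q))" and p: "p \<in> W"
  shows "D p (X p) (\<lambda>q. D q (Y q) Z) =
      Dg p (X p) (\<lambda>q. Dg q (Y q) Z)
      + (X p (\<lambda>q. \<theta> q (Y q)) *\<^sub>t Z p + \<theta> p (Y p) *\<^sub>t Dg p (X p) Z)
      + (X p (\<lambda>q. \<theta> q (Z q)) *\<^sub>t Y p + \<theta> p (Z p) *\<^sub>t Dg p (X p) Y)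
      + (- X p (\<lambda>q. g q (Y q) (Z q)) *\<^sub>t \<theta>s p + (- g p (Y p) (Z p)) *\<^sub>t Dg p (X p) \<theta>s)
      + (- X p (\<lambda>q. T q (Y q) (Z q)) *\<^sub>t \<xi> p + (- T p (Y p) (Z p)) *\<^sub>t Dg p (X p) \<xi>)
      + theta_tilde g \<theta> \<theta>s T \<xi> p (X p) (Dg p (Y p) Z + theta_tilde g \<theta> \<theta>s T \<xi> p (Y p) (Z p))"
proof -
  have \<theta>sW: "vector_field A W \<theta>s" and \<xi>W: "vector_field A W \<xi>"
    using vector_field_subset[OF \<theta>s W(2)] vector_field_subset[OF \<xi> W(2)] .
  have x: "X p \<in> tangent_space A p" by (rule vector_field_tangent[OF X p])
  have \<theta>Y: "smooth_fun A W (\<lambda>q. \<theta> q (Y q))" and \<theta>Z: "smooth_fun A W (\<lambda>q. \<theta> q (Z q))"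
    using one_form_smooth[OF \<theta> W(1) subset_UNIV Y] one_form_smooth[OF \<theta> W(1) subset_UNIV Z] .
  have TYZ: "smooth_fun A W (\<lambda>q. T q (Y q) (Z q))" by (rule sym_tensor2_smooth[OF T W Y Z])
  have neg: "smooth_fun A W (\<lambda>q. - f q)" "X p (\<lambda>q. - f q) = - X p f"
    if "smooth_fun A W f" for f
    using smooth_fun_minus[OF A W(1) that]
      tangent_cmult[OF x smooth_nearI[OF that W(1) p], of "-1"] by simp_all
  note gYZ' = neg[OF gYZ] and TYZ' = neg[OF TYZ]
  \<comment> \<open>\<open>f0\<close> to \<open>f4\<close> concern the five summands and
    \<open>s1\<close> to \<open>s4\<close> the partial sums, which must be vector fields before
    additivity of the connection can split them.\<close>
  note f0 = connection_field[OF Dg W Z Y]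
  note f1 = vector_field_fscale[OF A \<theta>Y Z]
  note f2 = vector_field_fscale[OF A \<theta>Z Y]
  note f3 = vector_field_fscale[OF A gYZ'(1) \<theta>sW]
  note f4 = vector_field_fscale[OF A TYZ'(1) \<xi>W]
  note s1 = vector_field_add[OF A f0 f1]
  note s2 = vector_field_add[OF A s1 f2]
  note s3 = vector_field_add[OF A s2 f3]
  note s4 = vector_field_add[OF A s3 f4]
  let ?V = "\<lambda>q. Dg q (Y q) Z + \<theta> q (Y q) *\<^sub>t Z q + \<theta> q (Z q) *\<^sub>t Y q
    + (- g q (Y q) (Z q)) *\<^sub>t \<theta>s q + (- T q (Y q) (Z q)) *\<^sub>t \<xi> q"
  have V: "D q (Y q) Z = ?V q" if "q \<in> W" for q
    using weyl_connection_eq[OF W Y Z that] by (simp only: theta_tilde_eq_sum)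
  have Vp: "?V p = Dg p (Y p) Z + theta_tilde g \<theta> \<theta>s T \<xi> p (Y p) (Z p)"
    by (simp only: theta_tilde_eq_sum)
  \<comment> \<open>The expansion \<open>?V\<close> agrees with \<open>D_Y Z\<close> on
    \<open>W\<close> only, so locality of \<open>D\<close> is used.\<close>
  have "D p (X p) (\<lambda>q. D q (Y q) Z) = D p (X p) ?V"
    by (rule connection_cong[OF D W(1) subset_UNIV s4 p x V])
  also have "\<dots> = Dg p (X p) ?V + theta_tilde g \<theta> \<theta>s T \<xi> p (X p) (?V p)"
    by (rule weyl_connection_eq[OF W X s4 p])
  also have "Dg p (X p) ?V = Dg p (X p) (\<lambda>q. Dg q (Y q) Z)
      + (X p (\<lambda>q. \<theta> q (Y q)) *\<^sub>t Z p + \<theta> p (Y p) *\<^sub>t Dg p (X p) Z)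
      + (X p (\<lambda>q. \<theta> q (Z q)) *\<^sub>t Y p + \<theta> p (Z p) *\<^sub>t Dg p (X p) Y)
      + (- X p (\<lambda>q. g q (Y q) (Z q)) *\<^sub>t \<theta>s p + (- g p (Y p) (Z p)) *\<^sub>t Dg p (X p) \<theta>s)
      + (- X p (\<lambda>q. T q (Y q) (Z q)) *\<^sub>t \<xi> p + (- T p (Y p) (Z p)) *\<^sub>t Dg p (X p) \<xi>)"
    by (simp only: connection_add[OF Dg W s3 p x f4] connection_add[OF Dg W s2 p x f3]
        connection_add[OF Dg W s1 p x f2] connection_add[OF Dg W f0 p x f1]
        connection_leibniz[OF Dg W Z p x \<theta>Y] connection_leibniz[OF Dg W Y p x \<theta>Z]
        connection_leibniz[OF Dg W \<theta>sW p x gYZ'(1)] connection_leibniz[OF Dg W \<xi>W p x TYZ'(1)]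
        gYZ'(2) TYZ'(2))
  finally show ?thesis unfolding Vp .
qed

section \<open>The curvature identity for a metric reference connection\<close>

context
  assumes Dg_tf: "torsion_free A U Dg" and Dg_metric: "metric_connection A U Dg g"
    and g: "sym_bilinear_on A UNIV g"
    and \<theta>_sharp: "\<forall>q\<in>U. \<forall>w\<in>tangent_space A q. \<theta> q w = g q (\<theta>s q) w"
    and \<xi>_radical: "\<forall>q\<in>U. \<forall>w\<in>tangent_space A q. g q (\<xi> q) w = 0"
    and \<phi>: "\<forall>q\<in>U. \<forall>v\<in>tangent_space A q. Dg q v \<xi> = \<phi> q v *\<^sub>t \<xi> q"
begin

text \<open>Metric compatibility moves the derivative of \<open>g(\<theta>s, Z)\<close> onto the two
  arguments. The function \<theta>(Z) supplies the smoothness needed to exchange it for this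
  pairing.\<close>

lemma derivative_of_theta:
  assumes W: "open W" "W \<subseteq> U" "p \<in> W" and Z: "vector_field A W Z" and v: "v \<in> tangent_space A p"
  shows "v (\<lambda>q. \<theta> q (Z q)) = g p (Dg p v \<theta>s) (Z p) + \<theta> p (Dg p v Z)"
proof -
  have \<theta>sW: "vector_field A W \<theta>s" by (rule vector_field_subset[OF \<theta>s W(2)])
  have "v (\<lambda>q. \<theta> q (Z q)) = v (\<lambda>q. g q (\<theta>s q) (Z q))"
  proof (rule tangent_space_cong[OF v _ W(1,3)])
    show "smooth_near A p (\<lambda>q. \<theta> q (Z q))"
      by (rule smooth_nearI[OF one_form_smooth[OF \<theta> W(1) subset_UNIV Z] W(1,3)])
    show "\<theta> q (Z q) = g q (\<theta>s q) (Z q)" if "q \<in> W" for q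
      by (rule \<theta>_sharp[rule_format, OF subsetD[OF W(2) that] vector_field_tangent[OF Z that]])
  qed
  also have "\<dots> = g p (Dg p v \<theta>s) (Z p) + g p (\<theta>s p) (Dg p v Z)"
    by (rule metric_connectionD[OF Dg_metric W(1,2) \<theta>sW Z W(3) v])
  also have "g p (\<theta>s p) (Dg p v Z) = \<theta> p (Dg p v Z)"
    by (rule \<theta>_sharp[rule_format, OF subsetD[OF W(2,3)] connection_tangent[OF Dg W(1,2) Z W(3) v], symmetric])
  finally show ?thesis .
qed

text \<open>After antisymmetrising the second derivatives, the derivatives of \<theta>(X) and
  \<theta>(Y) join the bracket to form the exterior derivative, those of \<open>g\<close> are
  removed by compatibility, and those of \<open>T\<close> complete to covariant derivatives in
  \<open>K_form\<close>.\<close>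

lemma weyl_curvature:
  assumes W: "open W" "W \<subseteq> U" and X: "vector_field A W X" and Y: "vector_field A W Y"
    and Z: "vector_field A W Z" and smooth: "smooth_fun A W (\<lambda>q. g q (X q) (Z q))"
      "smooth_fun A W (\<lambda>q. g q (Y q) (Z q))" and p: "p \<in> W"
  shows "curvature A D X Y Z p =
     curvature A Dg X Y Z p
     - (2 * ext_deriv A \<theta> X Y p) *\<^sub>t Z p
     + wedge_endo g p (wedge_term g Dg \<theta> \<theta>s Y p) (X p) (Z p)
     - wedge_endo g p (wedge_term g Dg \<theta> \<theta>s X p) (Y p) (Z p)
     + (K_form g Dg \<theta>s T \<xi> \<phi> X Y Z p - K_form g Dg \<theta>s T \<xi> \<phi> Y X Z p) *\<^sub>t \<xi> p"
proof -
  have pU: "p \<in> U" using W p by blast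
  have \<theta>sW: "vector_field A W \<theta>s" by (rule vector_field_subset[OF \<theta>s W(2)])
  have Tb: "sym_bilinear_on A U T" by (rule sym_tensor2_bilinear[OF T])
  \<comment> \<open>Fields survive only under derivatives; everything else becomes algebra of
    tangent vectors at \<open>p\<close>.\<close>
  define x y z s k where "x = X p" "y = Y p" "z = Z p" "s = \<theta>s p" "k = \<xi> p"
  note pt = this
  define a b zx zy sx sy where "a = Dg p x Y" "b = Dg p y X" "zx = Dg p x Z" "zy = Dg p y Z"
    "sx = Dg p x \<theta>s" "sy = Dg p y \<theta>s"
  note der = this
  have xy: "x \<in> tangent_space A p" "y \<in> tangent_space A p"
    unfolding pt by (rule vector_field_tangent[OF X p], rule vector_field_tangent[OF Y p])
  have t: "z \<in> tangent_space A p" "s \<in> tangent_space A p" "k \<in> tangent_space A p"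
    "a \<in> tangent_space A p" "b \<in> tangent_space A p" "zx \<in> tangent_space A p"
    "zy \<in> tangent_space A p" "sx \<in> tangent_space A p" "sy \<in> tangent_space A p"
    unfolding der unfolding pt(3-5)
    by (rule vector_field_tangent[OF Z p] vector_field_tangent[OF \<theta>s pU]
        vector_field_tangent[OF \<xi> pU] connection_tangent[OF Dg W Y p xy(1)]
        connection_tangent[OF Dg W X p xy(2)] connection_tangent[OF Dg W Z p xy(1)]
        connection_tangent[OF Dg W Z p xy(2)] connection_tangent[OF Dg W \<theta>sW p xy(1)]
        connection_tangent[OF Dg W \<theta>sW p xy(2)])+
  note tangent = xy t tangent_space_add tangent_space_fscale
  have \<theta>g: "\<theta> p w = g p s w" if "w \<in> tangent_space A p" for w
    using \<theta>_sharp[rule_format, OF pU that] by (simp only: pt)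
  have gk: "g p w k = 0" if "w \<in> tangent_space A p" for w
    using \<xi>_radical[rule_format, OF pU that] sym_bilinear_sym[OF g UNIV_I that t(3)] by (simp only: pt)
  note lin = sym_bilinear_add_left[OF g UNIV_I] sym_bilinear_fscale_left[OF g UNIV_I]
    sym_bilinear_add_right[OF g UNIV_I] sym_bilinear_fscale_right[OF g UNIV_I]
    sym_bilinear_add_left[OF Tb pU] sym_bilinear_fscale_left[OF Tb pU]
    sym_bilinear_add_right[OF Tb pU] sym_bilinear_fscale_right[OF Tb pU]
    one_form_add[OF \<theta> UNIV_I] one_form_fscale[OF \<theta> UNIV_I]
  \<comment> \<open>One normal form for the pairings, in which terms symmetric in \<open>X\<close>
    and \<open>Y\<close> cancel.\<close>
  have sym: "g p y x = g p x y" "g p x s = \<theta> p x" "g p y s = \<theta> p y" "g p s z = \<theta> p z" "\<theta> p s = g p s s"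
    "\<theta> p k = 0" "T p y x = T p x y"
    by (simp_all only: \<theta>g tangent sym_bilinear_sym[OF g UNIV_I xy(2,1)]
        sym_bilinear_sym[OF g UNIV_I xy(1) t(2)] sym_bilinear_sym[OF g UNIV_I xy(2) t(2)]
        sym_bilinear_sym[OF Tb pU xy(2,1)] gk)
  have L: "lie_bracket A X Y p = a + (-1) *\<^sub>t b"
    unfolding der pt by (rule torsion_freeD[OF Dg_tf W X Y p])
  have tilde: "x' + theta_tilde g \<theta> \<theta>s T \<xi> p u v
     = x' + \<theta> p u *\<^sub>t v + \<theta> p v *\<^sub>t u + (- g p u v) *\<^sub>t s + (- T p u v) *\<^sub>t k" for x' u v
    unfolding pt by (rule theta_tilde_eq_sum)
  \<comment> \<open>\<open>weyl_connection_eq\<close> takes its direction from a vector field; this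
    one has the bracket as its value at \<open>p\<close>.\<close>
  have B: "vector_field A W (\<lambda>q. Dg q (X q) Y + (-1) *\<^sub>t Dg q (Y q) X)"
    by (intro vector_field_add[OF A] vector_field_fscale[OF A] smooth_fun_const[OF A W(1)]
        connection_field[OF Dg W Y X] connection_field[OF Dg W X Y])
  have DL: "D p (lie_bracket A X Y p) Z
      = Dg p (lie_bracket A X Y p) Z + theta_tilde g \<theta> \<theta>s T \<xi> p (lie_bracket A X Y p) z"
    using weyl_connection_eq[OF W B Z p] by (simp only: L der pt)
  note second = weyl_second_derivative[OF W X Y Z smooth(2) p, folded pt, folded der]
    weyl_second_derivative[OF W Y X Z smooth(1) p, folded pt, folded der]
  have d\<theta>: "x (\<lambda>q. \<theta> q (Z q)) = g p sx z + \<theta> p zx" "y (\<lambda>q. \<theta> q (Z q)) = g p sy z + \<theta> p zy"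
    unfolding der pt(3)
    by (rule derivative_of_theta[OF W p Z xy(1)], rule derivative_of_theta[OF W p Z xy(2)])
  have dg: "x (\<lambda>q. g q (Y q) (Z q)) = g p a z + g p y zx"
    "y (\<lambda>q. g q (X q) (Z q)) = g p b z + g p x zy"
    using metric_connectionD[OF Dg_metric W Y Z p xy(1)] metric_connectionD[OF Dg_metric W X Z p xy(2)]
    by (simp_all only: der pt)
  have d\<xi>: "Dg p x \<xi> = \<phi> p x *\<^sub>t k" "Dg p y \<xi> = \<phi> p y *\<^sub>t k"
    using \<phi>[rule_format, OF pU xy(1)] \<phi>[rule_format, OF pU xy(2)] by (simp_all only: pt)
  show ?thesis
    unfolding curvature_def ext_deriv_def wedge_endo_def wedge_term_eq_sum K_form_def cov_deriv2_def
      pt[symmetric] der[symmetric] second d\<theta> dg d\<xi> DL tilde unfolding L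
    \<comment> \<open>Multilinear expansion comes first; evaluation on a test function then leaves
      an identity of real numbers. The coefficients \<theta>(X)T(Y,Z) + \<theta>(Y)T(X,Z) and
      \<theta>(Z)T(X,Y) of \<xi> drop out by symmetry.\<close>
    by (simp only: lin sym tangent gk mult_zero_right minus_zero)
      (simp add: fun_eq_iff fscale_def field_simps)
qed

end
end

section \<open>The curvature formula for a Weyl screen structure\<close>

theorem proposition3p1:
  fixes A :: "('m::{t2_space,second_countable_topology}, 'e::euclidean_space) atlas"
    and B :: "('k::{t2_space,second_countable_topology}, 'f::euclidean_space) atlas"
    and F :: "'m \<Rightarrow> 'k" and n :: nat
    and gbar :: "'k tensor2" and nabla_bar :: "'k connection"
    and g\<^sub>0 g :: "'m tensor2" and S :: "'m \<Rightarrow> 'm tangent set"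
    and D Dg :: "'m connection" and U :: "'m set"
    and \<xi> \<theta>s :: "'m vfield" and \<eta> \<theta> \<phi> :: "'m form" and C T :: "'m tensor2"
  assumes hypersurface: "hypersurface A B F"
    and dim: "DIM('f) = n + 2"
    and lorentzian: "lorentzian_metric B gbar"
    and levi_civita: "levi_civita B gbar nabla_bar"
    and g0: "g\<^sub>0 = induced_metric B F gbar"
    and rank: "\<forall>p. rank_at A g\<^sub>0 p = n"
    and totally_geodesic: "totally_geodesic A B F gbar nabla_bar"
    and screen: "screen_distribution A n g\<^sub>0 S"
    and integrable: "integrable_distribution A S"
    and weyl: "weyl_screen_structure A g\<^sub>0 S D"
    and g: "g \<in> conformal_class A g\<^sub>0"
    and \<theta>: "weyl_form A D g \<theta>"
    and U: "open U"
    and \<xi>: "vector_field A U \<xi>" "\<forall>p\<in>U. \<xi> p \<in> Rad A g\<^sub>0 p \<and> \<xi> p \<noteq> 0"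
    and \<xi>_normalised: "\<forall>p\<in>U. D p (\<xi> p) \<xi> = 0"
    and \<eta>: "one_form A U \<eta>" "\<forall>p\<in>U. \<eta> p (\<xi> p) = 1 \<and> {v \<in> tangent_space A p. \<eta> p v = 0} = S p"
    and \<theta>_sharp: "is_sharp A U g \<eta> \<theta> \<theta>s"
    and Dg: "linear_connection A U Dg" "torsion_free A U Dg" "metric_connection A U Dg g"
      "\<forall>p\<in>U. Dg p (\<xi> p) \<xi> = 0"
    and C: "screen_second_form A U g\<^sub>0 S \<xi> Dg C"
    and T: "sym_tensor2 A U T" "\<forall>p\<in>U. T p (\<xi> p) (\<xi> p) = 0"
      "\<forall>p\<in>U. \<forall>x\<in>tangent_space A p. \<forall>y\<in>S p. T p x y = C p x y + \<eta> p x * \<theta> p y"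
    and D_eq: "\<forall>W X Y. open W \<and> W \<subseteq> U \<and> vector_field A W X \<and> vector_field A W Y \<longrightarrow>
      (\<forall>p\<in>W. D p (X p) Y = Dg p (X p) Y + theta_tilde g \<theta> \<theta>s T \<xi> p (X p) (Y p))"
    and \<phi>: "one_form A U \<phi>" "\<forall>p\<in>U. \<forall>v\<in>tangent_space A p. Dg p v \<xi> = \<phi> p v *\<^sub>t \<xi> p"
  shows "\<forall>W X Y Z. open W \<and> W \<subseteq> U \<and>
      vector_field A W X \<and> vector_field A W Y \<and> vector_field A W Z \<longrightarrow>
      (\<forall>p\<in>W. curvature A D X Y Z p =
         curvature A Dg X Y Z p
         - (2 * ext_deriv A \<theta> X Y p) *\<^sub>t Z p
         + wedge_endo g p (wedge_term g Dg \<theta> \<theta>s Y p) (X p) (Z p)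
         - wedge_endo g p (wedge_term g Dg \<theta> \<theta>s X p) (Y p) (Z p)
         + (K_form g Dg \<theta>s T \<xi> \<phi> X Y Z p - K_form g Dg \<theta>s T \<xi> \<phi> Y X Z p) *\<^sub>t \<xi> p)"
proof (intro allI impI ballI; elim conjE)
  fix W X Y Z p
  assume W: "open W" "W \<subseteq> U" and XYZ: "vector_field A W X" "vector_field A W Y" "vector_field A W Z"
    and p: "p \<in> W"
  have A: "smooth_atlas A" and B: "smooth_atlas B" and F: "smooth_map A B F"
    using hypersurface by (simp_all add: hypersurface_def)
  have "sym_bilinear_on B UNIV gbar"
    using lorentzian by (simp add: lorentzian_metric_def sym_tensor2_bilinear)
  then have bilinear: "sym_bilinear_on A UNIV g"
    using conformal_class_bilinear[OF g] induced_metric_bilinear[OF A B F] g0 by blast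
  have D: "linear_connection A UNIV D"
    using weyl by (simp add: weyl_screen_structure_def weyl_structure_def)
  have \<theta>_form: "one_form A UNIV \<theta>" using \<theta> by (simp add: weyl_form_def)
  have \<theta>s: "vector_field A U \<theta>s" using \<theta>_sharp by (simp add: is_sharp_def)
  have \<xi>_tangent: "\<xi> q \<in> tangent_space A q" if "q \<in> U" for q
    by (rule vector_field_tangent[OF \<xi>(1) that])
  have \<xi>_Rad: "\<xi> q \<in> Rad A g q" if "q \<in> U" for q
    using \<xi>(2) that by (simp add: Rad_conformal_class[OF g])
  have \<xi>_radical: "\<forall>q\<in>U. \<forall>w\<in>tangent_space A q. g q (\<xi> q) w = 0"
    using \<xi>_Rad by (simp add: Rad_def)
  \<comment> \<open>Both connections annihilate \<xi> along itself, so their difference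
    \<open>theta_tilde\<close> does too; as \<open>g\<close> and \<open>T\<close> vanish on this
    pair, it equals twice \<theta>(\<xi>) times \<xi>.\<close>
  have \<theta>_\<xi>: "\<theta> q (\<xi> q) = 0" if q: "q \<in> U" for q
  proof -
    have "0 = theta_tilde g \<theta> \<theta>s T \<xi> q (\<xi> q) (\<xi> q)"
      using D_eq[rule_format, of U \<xi> \<xi> q] U \<xi>(1) \<xi>_normalised Dg(4) q by simp
    also have "\<dots> = (2 * \<theta> q (\<xi> q)) *\<^sub>t \<xi> q"
      using T(2) q \<xi>_radical[rule_format, OF q \<xi>_tangent[OF q]]
      by (simp add: theta_tilde_def fun_eq_iff fscale_def)
    finally have "\<forall>f. \<theta> q (\<xi> q) * \<xi> q f = 0" by (simp add: fun_eq_iff fscale_def)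
    moreover obtain f where "\<xi> q f \<noteq> 0" using \<xi>(2) q by (auto simp: fun_eq_iff)
    ultimately show ?thesis by (metis mult_eq_0_iff)
  qed
  \<comment> \<open>Evaluating the definition of the sharp at \<xi> isolates its \<eta>-component,
    which is therefore 0.\<close>
  have sharp: "\<forall>q\<in>U. \<forall>w\<in>tangent_space A q. \<theta> q w = g q (\<theta>s q) w"
  proof (intro ballI)
    fix q w assume q: "q \<in> U" and w: "w \<in> tangent_space A q"
    have s: "\<theta> q w = g q (\<theta>s q) w + \<eta> q (\<theta>s q) * \<eta> q w"
      if "w \<in> tangent_space A q" for w
      using \<theta>_sharp q that by (simp add: is_sharp_def)
    have "g q (\<theta>s q) (\<xi> q) = 0"
      using sym_bilinear_sym[OF bilinear UNIV_I \<xi>_tangent[OF q] vector_field_tangent[OF \<theta>s q]]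
        \<xi>_radical[rule_format, OF q vector_field_tangent[OF \<theta>s q]] by simp
    then have "\<eta> q (\<theta>s q) = 0"
      using s[OF \<xi>_tangent[OF q]] \<theta>_\<xi>[OF q] \<eta>(2) q by simp
    then show "\<theta> q w = g q (\<theta>s q) w" using s[OF w] by simp
  qed
  have pU: "p \<in> U" using W p by blast
  have \<xi>p: "\<xi> p \<noteq> 0" using \<xi>(2) pU by blast
  \<comment> \<open>The section \<xi> supplies the nonzero tangent vector at \<open>p\<close> on
    which the smoothness argument rests.\<close>
  note near = metric_smooth_near[OF A Dg(1) Dg(3) bilinear
      screen_distribution_conformal_class[OF g screen] W p _ _ \<xi>_tangent[OF pU] \<xi>p]
  obtain V\<^sub>1 where V\<^sub>1: "open V\<^sub>1" "p \<in> V\<^sub>1" "smooth_fun A V\<^sub>1 (\<lambda>q. g q (X q) (Z q))"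
    using near[OF XYZ(1,3)] unfolding smooth_near_def by blast
  obtain V\<^sub>2 where V\<^sub>2: "open V\<^sub>2" "p \<in> V\<^sub>2" "smooth_fun A V\<^sub>2 (\<lambda>q. g q (Y q) (Z q))"
    using near[OF XYZ(2,3)] unfolding smooth_near_def by blast
  \<comment> \<open>The identity at \<open>p\<close> may be proved on any smaller neighbourhood;
    this one makes both pairings with \<open>Z\<close> smooth.\<close>
  let ?W = "W \<inter> V\<^sub>1 \<inter> V\<^sub>2"
  have sub: "?W \<subseteq> W" "?W \<subseteq> U" "?W \<subseteq> V\<^sub>1" "?W \<subseteq> V\<^sub>2" using W by auto
  have W': "open ?W" and pW': "p \<in> ?W" using W V\<^sub>1 V\<^sub>2 p by auto
  show "curvature A D X Y Z p =
         curvature A Dg X Y Z p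
         - (2 * ext_deriv A \<theta> X Y p) *\<^sub>t Z p
         + wedge_endo g p (wedge_term g Dg \<theta> \<theta>s Y p) (X p) (Z p)
         - wedge_endo g p (wedge_term g Dg \<theta> \<theta>s X p) (Y p) (Z p)
         + (K_form g Dg \<theta>s T \<xi> \<phi> X Y Z p - K_form g Dg \<theta>s T \<xi> \<phi> Y X Z p) *\<^sub>t \<xi> p"
    by (rule weyl_curvature[where A = A and g = g and T = T and D = D and Dg = Dg and U = U
          and \<xi> = \<xi> and \<theta>s = \<theta>s and \<theta> = \<theta> and \<phi> = \<phi> and W = ?W and X = X and Y = Y and Z = Z and p = p,
          OF A D Dg(1) \<theta>_form T(1) \<theta>s \<xi>(1) D_eq Dg(2,3) bilinear sharp \<xi>_radical \<phi>(2) W' sub(2)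
          vector_field_subset[OF XYZ(1) sub(1)] vector_field_subset[OF XYZ(2) sub(1)]
          vector_field_subset[OF XYZ(3) sub(1)] smooth_fun_subset[OF V\<^sub>1(3) sub(3)]
          smooth_fun_subset[OF V\<^sub>2(3) sub(4)] pW'])
qed

end
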